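(* Let $Q$ be an $n\times n$ Hermitian positive definite matrix, $A$ an $mn\times n$ matrix, $\Delta A$ an $mn\times n$ matrix, $\Delta Q\in\mathcal{H}^n$, and put $\tilde A=A+\Delta A$, $\tilde Q=Q+\Delta Q$, with $\tilde Q>0$. Suppose that the equation $X+A^*\widehat{X}^{-1}A=Q$ has a maximal positive definite solution $X_L$. Let $\|\cdot\|_U$ be a unitarily invariant norm and let \begin{align*} b&=1-K_U\big\|\widehat{X_L^{-1}}A\big\|+\|X_L^{-1}\|\,\|\Delta Q\|_U,\\ c&=\|\Delta Q\|_U+2\,\big\|\widehat{X_L^{-1}}A\big\|\,\|\Delta A\|_U+\|X_L^{-1}\|\,\|\Delta A\|_U^2, \end{align*} where $$K_U=\min\big\{\theta_U(m)\,\big\|\widehat{X_L^{-1}}A\big\|,\ \big\|\widehat{X_L^{-1}}A\big\|_U\big\}.$$ If $$K_U\big\|\widehat{X_L^{-1}}A\big\|<1\quad\text{and}\quad 2\|\Delta A\|_U+\|\Delta Q\|_U<\frac{\Big(1-\sqrt{K_U\big\|\widehat{X_L^{-1}}A\big\|}\Big)^2}{\|X_L^{-1}\|},$$ then $D:=b^2-4c\|X_L^{-1}\|>0$, the perturbed equation $\tilde X+\tilde A^*\widehat{\tilde X^{-1}}\tilde A=\tilde Q$ has a maximal positive definite solution $\tilde X_L$, and $\Delta X_L:=\tilde X_L-X_L$ satisfies $$\|\Delta X_L\|_U\le\frac{b-\sqrt{D}}{2\|X_L^{-1}\|}=:S_{err}.$$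
   Context: $\mathcal{H}^n$ is the set of $n\times n$ Hermitian matrices; $M>0$ ($M\ge 0$) means $M$ is positive definite (semidefinite), and $M\ge N$ means $M-N\ge 0$. $A^*$ is the conjugate transpose. For an $n\times n$ matrix $Z$, $\widehat{Z}=I_m\otimes Z=\mathrm{diag}(Z,\dots,Z)$ is the $m\times m$ block diagonal matrix with $Z$ on its diagonal; in particular $\widehat{Z}^{-1}=\widehat{Z^{-1}}$. A Hermitian solution $X_L$ of such an equation is called maximal if $X_L\ge X$ for an arbitrary Hermitian solution $X$; a maximal positive definite solution is a maximal solution that is positive definite. $\|\cdot\|$ is the spectral norm and $\|\cdot\|_U$ is any unitarily invariant matrix norm, used on matrices of different sizes and having the usual properties $\|Z\|\le\|Z\|_U$ and $\|XYZ\|_U\le\|X\|\,\|Y\|_U\,\|Z\|$. The quantity $\theta_U(m)$ is defined by $\theta_U(m)=\|\widehat{Z}\|_U/\|Z\|_U$ for an $n\times n$ (nonzero) matrix $Z$; for the spectral norm its value is $1$ and for the Frobenius norm it is $\sqrt m$.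
   Formalization: "Maximal" is taken among positive definite solutions, in hypothesis and conclusion alike, rather than among all Hermitian solutions; with indefinite Hermitian competitors the perturbed equation can fail to have a maximal solution. *)

theory Defs
  imports
    "Jordan_Normal_Form.Schur_Decomposition"
    "Jordan_Normal_Form.Gauss_Jordan_Elimination"
begin

definition hermitian_mat :: "nat \<Rightarrow> complex mat \<Rightarrow> bool" where
  "hermitian_mat n M \<longleftrightarrow> M \<in> carrier_mat n n \<and> mat_adjoint M = M"

(* (M *\<^sub>v v) \<bullet>c v is v^* M v, which is real for Hermitian M. *)

definition pos_def :: "nat \<Rightarrow> complex mat \<Rightarrow> bool" where
  "pos_def n M \<longleftrightarrow> hermitian_mat n M \<and>
     (\<forall>v \<in> carrier_vec n. v \<noteq> 0\<^sub>v n \<longrightarrow> 0 < Re ((M *\<^sub>v v) \<bullet>c v))"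

definition pos_semidef :: "nat \<Rightarrow> complex mat \<Rightarrow> bool" where
  "pos_semidef n M \<longleftrightarrow> hermitian_mat n M \<and>
     (\<forall>v \<in> carrier_vec n. 0 \<le> Re ((M *\<^sub>v v) \<bullet>c v))"

(* The order \<le> that the library puts on matrices is entrywise, hence a separate name
   for the order of Hermitian matrices. *)

definition loewner_le :: "nat \<Rightarrow> complex mat \<Rightarrow> complex mat \<Rightarrow> bool" where
  "loewner_le n M N \<longleftrightarrow> pos_semidef n (N - M)"

definition unitary_mat :: "nat \<Rightarrow> complex mat \<Rightarrow> bool" where
  "unitary_mat n U \<longleftrightarrow> U \<in> carrier_mat n n \<and>
     mat_adjoint U * U = 1\<^sub>m n \<and> U * mat_adjoint U = 1\<^sub>m n"

(* Unspecified for singular matrices. *)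

definition inv_mat :: "complex mat \<Rightarrow> complex mat" where
  "inv_mat M = the (mat_inverse M)"

definition hat :: "nat \<Rightarrow> complex mat \<Rightarrow> complex mat" where
  "hat m Z = diag_block_mat (replicate m Z)"

definition vec_norm2 :: "complex vec \<Rightarrow> real" where
  "vec_norm2 v = sqrt (\<Sum>i<dim_vec v. (cmod (v $ i))\<^sup>2)"

(* The operator norm induced by the Euclidean norms.  The supremum is over the closed
   unit ball, not the unit sphere, so that it is also meaningful without columns. *)

definition spec_norm :: "complex mat \<Rightarrow> real" where
  "spec_norm M =
     Sup {vec_norm2 (M *\<^sub>v v) | v. v \<in> carrier_vec (dim_col M) \<and> vec_norm2 v \<le> 1}"

(* One function measures the matrices of all sizes: a norm on each space of r by c
   matrices, the different sizes being related by the last two properties. *)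

definition unitarily_invariant_norm :: "(complex mat \<Rightarrow> real) \<Rightarrow> bool" where
  "unitarily_invariant_norm N \<longleftrightarrow>
     (\<forall>r c. \<forall>X \<in> carrier_mat r c. 0 \<le> N X \<and> (N X = 0 \<longleftrightarrow> X = 0\<^sub>m r c)) \<and>
     (\<forall>r c a. \<forall>X \<in> carrier_mat r c. N (a \<cdot>\<^sub>m X) = cmod a * N X) \<and>
     (\<forall>r c. \<forall>X \<in> carrier_mat r c. \<forall>Y \<in> carrier_mat r c. N (X + Y) \<le> N X + N Y) \<and>
     (\<forall>r c U V. \<forall>X \<in> carrier_mat r c. unitary_mat r U \<and> unitary_mat c V \<longrightarrow> N (U * X * V) = N X) \<and>
     (\<forall>r c. \<forall>X \<in> carrier_mat r c. spec_norm X \<le> N X) \<and>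
     (\<forall>p q r s. \<forall>X \<in> carrier_mat p q. \<forall>Y \<in> carrier_mat q r. \<forall>Z \<in> carrier_mat r s.
        N (X * Y * Z) \<le> spec_norm X * N Y * spec_norm Z)"

(* The constant theta_U(m) is defined by the quotient below, which presupposes that the
   quotient is the same for all nonzero n by n matrices Z.  For n > 0 there is at most one
   such t. *)

definition is_theta :: "(complex mat \<Rightarrow> real) \<Rightarrow> nat \<Rightarrow> nat \<Rightarrow> real \<Rightarrow> bool" where
  "is_theta N n m t \<longleftrightarrow>
     (\<forall>Z \<in> carrier_mat n n. Z \<noteq> 0\<^sub>m n n \<longrightarrow> t = N (hat m Z) / N Z)"

definition hermitian_solution ::
  "nat \<Rightarrow> nat \<Rightarrow> complex mat \<Rightarrow> complex mat \<Rightarrow> complex mat \<Rightarrow> bool" where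
  "hermitian_solution m n A Q X \<longleftrightarrow>
     hermitian_mat n X \<and> invertible_mat X \<and>
     X + mat_adjoint A * inv_mat (hat m X) * A = Q"

(* The competitors Y are the positive definite solutions.  A positive definite solution
   that dominates them need not dominate the indefinite Hermitian solutions: for n = m = 3,
   Q = diag(1, 1.04, 1.01) and blocks A_1 = E_33 / 10, A_2 = E_32 / 5, A_3 = E_21 / 10
   the only Hermitian solutions are diag(0.99, 1, 1) and diag(1 + 1/296, -2.96, 0.01), and
   neither dominates the other. *)

definition maximal_pd_solution ::
  "nat \<Rightarrow> nat \<Rightarrow> complex mat \<Rightarrow> complex mat \<Rightarrow> complex mat \<Rightarrow> bool" where
  "maximal_pd_solution m n A Q X \<longleftrightarrow>
     hermitian_solution m n A Q X \<and> pos_def n X \<and>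
     (\<forall>Y. hermitian_solution m n A Q Y \<and> pos_def n Y \<longrightarrow> loewner_le n Y X)"

end

theory Submission
  imports Defs "HOL-Analysis.L2_Norm" "Jordan_Normal_Form.Spectral_Radius"
begin

text \<open>
  A solution of the perturbed equation near $X = X_L$ is written as $X + E$. Then $E$ is a fixed point
  of a map $\Phi$ that is defined where $X + E$ is positive definite. With $\kappa = \|X^{-1}\|$,
  $B = \widehat{X^{-1}}A$, $\beta = \|B\|$, $\delta = \|\Delta A\|_U$ and $q = \|\Delta Q\|_U$, the
  estimate $\|(X+E)^{-1}X\| \le 1/(1-\kappa S)$ for $\|E\|_U \le S$ leads to
  \[ \|\Phi(E)\|_U \le q + \frac{K_U\beta S + 2\beta\delta + \kappa\delta^2}{1-\kappa S}. \]
  For $\kappa S < 1$ the right-hand side equals $S$ exactly if $\kappa S^2 - bS + c = 0$, and $S_{err}$ is the smaller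
  root of this equation. So $\Phi$ maps the Hermitian matrices with $\|E\|_U \le S_{err}$ to
  themselves (\<open>fixpoint_map_norm_le\<close>, \<open>root_bounds\<close>).

  The existence of the fixed point and the maximality of the solution both come from one inequality,
  $\rho = (\beta + \kappa\delta)/(1-\kappa S_{err}) < 1$, where $\rho$ bounds
  $\|\widehat{(X+E)^{-1}}\tilde A\|$ on the ball. First,
  $\Phi(E) - \Phi(F) = V^*\,\widehat{E-F}\,U$ with two such matrices $U$, $V$, so $\Phi$ contracts the
  spectral norm by the factor $\rho^2$, and Banach's theorem applies
  (\<open>matrix_contraction_fixpoint\<close>). Second, a positive definite solution $X$ with
  $\|\widehat{X^{-1}}A\| < 1$ is maximal (\<open>maximal_if_spec_norm_less_1\<close>). The inequality
  $\rho < 1$ follows from the hypotheses because $\beta \le K_U$, which in turn rests on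
  $\theta_U(m) \ge 1$ (\<open>one_le_theta\<close>).

  The estimate of $\Phi$ contains a term that is the adjoint of another one. That
  the norm takes the same value on both follows from the polar decomposition, in the form that
  every square matrix $M$ has a unitary $W$ with $M^* = W M W$
  (\<open>exists_unitary_adjoint_eq\<close>).
\<close>

section \<open>Adjoints and matrix algebra\<close>

lemma adjoint_dims [simp]:
  "dim_row (mat_adjoint M) = dim_col M" "dim_col (mat_adjoint M) = dim_row M"
  by (simp_all add: mat_adjoint_def)

lemma adjoint_index [simp]:
  "i < dim_col M \<Longrightarrow> j < dim_row M \<Longrightarrow> mat_adjoint M $$ (i, j) = cnj (M $$ (j, i))"
  by (simp add: mat_adjoint_def mat_of_rows_index)

lemma adjoint_carrier [simp]: "M \<in> carrier_mat r c \<Longrightarrow> mat_adjoint M \<in> carrier_mat c r"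
  by (intro carrier_matI) auto

lemma adjoint_adjoint [simp]: "mat_adjoint (mat_adjoint M) = (M :: complex mat)"
  by (rule eq_matI) auto

lemma adjoint_one [simp]: "mat_adjoint (1\<^sub>m n) = (1\<^sub>m n :: complex mat)"
  by (rule eq_matI) auto

lemma adjoint_zero [simp]: "mat_adjoint (0\<^sub>m r c) = (0\<^sub>m c r :: complex mat)"
  by (rule eq_matI) auto

lemma adjoint_mult:
  fixes A B :: "complex mat"
  shows "dim_col A = dim_row B \<Longrightarrow> mat_adjoint (A * B) = mat_adjoint B * mat_adjoint A"
  by (rule eq_matI) (auto simp: scalar_prod_def intro!: sum.cong)

lemma adjoint_add:
  fixes A B :: "complex mat"
  shows "dim_row A = dim_row B \<Longrightarrow> dim_col A = dim_col B \<Longrightarrow>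
    mat_adjoint (A + B) = mat_adjoint A + mat_adjoint B"
  by (rule eq_matI) auto

lemma adjoint_minus:
  fixes A B :: "complex mat"
  shows "dim_row A = dim_row B \<Longrightarrow> dim_col A = dim_col B \<Longrightarrow>
    mat_adjoint (A - B) = mat_adjoint A - mat_adjoint B"
  by (rule eq_matI) auto

text \<open>
  Rewriting with \<^term>\<open>A \<in> carrier_mat r c\<close> premises would leave the simplifier to guess the middle
  dimensions of a product; equations between dimensions are decided by simplification.
\<close>

lemma mult_assoc_dim:
  fixes A B C :: "complex mat"
  shows "dim_col A = dim_row B \<Longrightarrow> dim_col B = dim_row C \<Longrightarrow> A * B * C = A * (B * C)"
  by (intro assoc_mult_mat[of A "dim_row A" "dim_col A" B "dim_col B" C "dim_col C"] carrier_matI) auto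

lemma mult_distrib_dim:
  fixes A B C :: "complex mat"
  shows
    "dim_row A = dim_row B \<Longrightarrow> dim_col A = dim_col B \<Longrightarrow> dim_col B = dim_row C \<Longrightarrow> (A + B) * C = A * C + B * C"
    "dim_row B = dim_row C \<Longrightarrow> dim_col B = dim_col C \<Longrightarrow> dim_col A = dim_row C \<Longrightarrow> A * (B + C) = A * B + A * C"
    "dim_row A = dim_row B \<Longrightarrow> dim_col A = dim_col B \<Longrightarrow> dim_col B = dim_row C \<Longrightarrow> (A - B) * C = A * C - B * C"
    "dim_row B = dim_row C \<Longrightarrow> dim_col B = dim_col C \<Longrightarrow> dim_col A = dim_row C \<Longrightarrow> A * (B - C) = A * B - A * C"
  by (auto intro!: carrier_matI
      add_mult_distrib_mat[of A "dim_row A" "dim_col A" B C "dim_col C"]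
      mult_add_distrib_mat[of A "dim_row A" "dim_col A" B "dim_col B" C]
      minus_mult_distrib_mat[of A "dim_row A" "dim_col A" B C "dim_col C"]
      mult_minus_distrib_mat[of A "dim_row A" "dim_col A" B "dim_col B" C])

lemma mult_mat_vec_assoc_dim:
  fixes A B :: "complex mat"
  shows "dim_col A = dim_row B \<Longrightarrow> dim_vec v = dim_col B \<Longrightarrow> A * B *\<^sub>v v = A *\<^sub>v (B *\<^sub>v v)"
  by (intro assoc_mult_mat_vec[of A "dim_row A" "dim_col A" B "dim_col B" v] carrier_matI carrier_vecI) auto

section \<open>The Euclidean norm and the spectral norm\<close>

lemma vec_norm2_L2: "vec_norm2 v = L2_set (\<lambda>i. cmod (v $ i)) {..<dim_vec v}"
  by (simp add: vec_norm2_def L2_set_def)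

lemma vec_norm2_nonneg [simp]: "0 \<le> vec_norm2 v"
  by (simp add: vec_norm2_def sum_nonneg)

lemma vec_norm2_zero [simp]: "vec_norm2 (0\<^sub>v n) = 0"
  by (simp add: vec_norm2_def)

lemma cscalar_self: "v \<bullet>c v = complex_of_real ((vec_norm2 v)\<^sup>2)"
  by (simp add: scalar_prod_def vec_norm2_def sum_nonneg complex_norm_square atLeast0LessThan del: of_real_power)

lemma vec_norm2_eq_0: "v \<in> carrier_vec n \<Longrightarrow> vec_norm2 v = 0 \<longleftrightarrow> v = 0\<^sub>v n"
  using conjugate_square_eq_0_vec[of v n] by (simp add: cscalar_self)

lemma vec_norm2_smult [simp]: "vec_norm2 (a \<cdot>\<^sub>v v) = cmod a * vec_norm2 v"
  by (simp add: vec_norm2_def norm_mult power_mult_distrib real_sqrt_mult flip: sum_distrib_left)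

lemma vec_norm2_add:
  assumes "dim_vec v = dim_vec w"
  shows "vec_norm2 (v + w) \<le> vec_norm2 v + vec_norm2 w"
proof -
  have "vec_norm2 (v + w) \<le> L2_set (\<lambda>i. cmod (v $ i) + cmod (w $ i)) {..<dim_vec w}"
    unfolding vec_norm2_L2 by (simp, rule L2_set_mono) (auto intro: norm_triangle_ineq)
  also have "\<dots> \<le> vec_norm2 v + vec_norm2 w"
    unfolding vec_norm2_L2 using L2_set_triangle_ineq assms by simp
  finally show ?thesis .
qed

lemma cauchy_schwarz_vec:
  assumes "dim_vec v = dim_vec w"
  shows "cmod (v \<bullet>c w) \<le> vec_norm2 v * vec_norm2 w"
proof -
  have "cmod (v \<bullet>c w) \<le> (\<Sum>i<dim_vec w. \<bar>cmod (v $ i)\<bar> * \<bar>cmod (w $ i)\<bar>)"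
    unfolding scalar_prod_def using assms
    by (auto intro!: order_trans[OF norm_sum] simp: norm_mult atLeast0LessThan)
  also have "\<dots> \<le> vec_norm2 v * vec_norm2 w"
    using L2_set_mult_ineq[of "\<lambda>i. cmod (v $ i)" "\<lambda>i. cmod (w $ i)" "{..<dim_vec w}"]
    by (simp add: vec_norm2_L2 assms)
  finally show ?thesis .
qed

lemma cscalar_adjoint:
  fixes M :: "complex mat"
  assumes "M \<in> carrier_mat r c" "v \<in> carrier_vec c" "w \<in> carrier_vec r"
  shows "(M *\<^sub>v v) \<bullet>c w = v \<bullet>c (mat_adjoint M *\<^sub>v w)"
proof -
  have "(M *\<^sub>v v) \<bullet>c w = (\<Sum>i<r. \<Sum>j<c. M $$ (i, j) * v $ j * cnj (w $ i))"
    using assms by (auto simp: scalar_prod_def atLeast0LessThan sum_distrib_right intro!: sum.cong)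
  also have "\<dots> = (\<Sum>j<c. \<Sum>i<r. M $$ (i, j) * v $ j * cnj (w $ i))"
    by (rule sum.swap)
  also have "\<dots> = v \<bullet>c (mat_adjoint M *\<^sub>v w)"
    using assms by (auto simp: scalar_prod_def atLeast0LessThan sum_distrib_left ac_simps intro!: sum.cong)
  finally show ?thesis .
qed

text \<open>
  A crude bound, whose purpose is twofold: the supremum that defines the spectral norm is over a
  bounded set, and entrywise convergence implies convergence in the spectral norm.
\<close>

lemma mult_vec_le_entry_sum:
  assumes "dim_vec v = dim_col M"
  shows "vec_norm2 (M *\<^sub>v v) \<le> (\<Sum>i<dim_row M. \<Sum>j<dim_col M. cmod (M $$ (i, j))) * vec_norm2 v"
proof -
  have e: "cmod (v $ j) \<le> vec_norm2 v" if "j < dim_vec v" for j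
    unfolding vec_norm2_L2 by (rule member_le_L2_set) (use that in auto)
  have "vec_norm2 (M *\<^sub>v v) \<le> (\<Sum>i<dim_row M. cmod ((M *\<^sub>v v) $ i))"
    unfolding vec_norm2_L2 using L2_set_le_sum[of "{..<dim_row M}" "\<lambda>i. cmod ((M *\<^sub>v v) $ i)"] by simp
  also have "\<dots> \<le> (\<Sum>i<dim_row M. \<Sum>j<dim_col M. cmod (M $$ (i, j)) * vec_norm2 v)"
  proof (rule sum_mono)
    fix i assume "i \<in> {..<dim_row M}"
    then have "(M *\<^sub>v v) $ i = (\<Sum>j<dim_col M. M $$ (i, j) * v $ j)"
      using assms by (auto simp: scalar_prod_def atLeast0LessThan)
    also have "cmod \<dots> \<le> (\<Sum>j<dim_col M. cmod (M $$ (i, j)) * vec_norm2 v)"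
      using e assms by (intro sum_norm_le) (auto simp: norm_mult intro!: mult_left_mono)
    finally show "cmod ((M *\<^sub>v v) $ i) \<le> (\<Sum>j<dim_col M. cmod (M $$ (i, j)) * vec_norm2 v)" .
  qed
  finally show ?thesis by (simp add: sum_distrib_right)
qed

lemma spec_norm_set_bdd:
  "bdd_above {vec_norm2 (M *\<^sub>v v) | v. v \<in> carrier_vec (dim_col M) \<and> vec_norm2 v \<le> 1}"
proof (rule bdd_aboveI, clarify)
  fix v :: "complex vec" assume v: "v \<in> carrier_vec (dim_col M)" "vec_norm2 v \<le> 1"
  have "0 \<le> (\<Sum>i<dim_row M. \<Sum>j<dim_col M. cmod (M $$ (i, j)))" by (simp add: sum_nonneg)
  then show "vec_norm2 (M *\<^sub>v v) \<le> (\<Sum>i<dim_row M. \<Sum>j<dim_col M. cmod (M $$ (i, j)))"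
    using mult_vec_le_entry_sum[of v M] v
    by (auto intro: order_trans mult_left_le)
qed

lemma spec_norm_nonneg [simp]: "0 \<le> spec_norm M"
proof -
  have "vec_norm2 (M *\<^sub>v 0\<^sub>v (dim_col M)) \<le> spec_norm M"
    unfolding spec_norm_def by (rule cSup_upper[OF _ spec_norm_set_bdd]) force
  then show ?thesis using vec_norm2_nonneg order_trans by blast
qed

lemma spec_norm_bound:
  assumes "dim_vec v = dim_col M"
  shows "vec_norm2 (M *\<^sub>v v) \<le> spec_norm M * vec_norm2 v"
proof (cases "vec_norm2 v = 0")
  case True
  then have "v = 0\<^sub>v (dim_col M)" using vec_norm2_eq_0[of v "dim_col M"] carrier_vecI[OF assms] by blast
  moreover have "M *\<^sub>v 0\<^sub>v (dim_col M) = 0\<^sub>v (dim_row M)"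
    by (rule eq_vecI) (auto simp: scalar_prod_def)
  ultimately show ?thesis by simp
next
  case False
  let ?w = "complex_of_real (1 / vec_norm2 v) \<cdot>\<^sub>v v"
  have "vec_norm2 ?w \<le> 1" using False by (simp add: norm_divide)
  moreover have "?w \<in> carrier_vec (dim_col M)" using assms by (intro carrier_vecI) simp
  ultimately have "vec_norm2 (M *\<^sub>v ?w) \<in>
      {vec_norm2 (M *\<^sub>v v) | v. v \<in> carrier_vec (dim_col M) \<and> vec_norm2 v \<le> 1}"
    by blast
  then have "vec_norm2 (M *\<^sub>v ?w) \<le> spec_norm M"
    unfolding spec_norm_def by (rule cSup_upper[OF _ spec_norm_set_bdd])
  moreover have "M *\<^sub>v ?w = complex_of_real (1 / vec_norm2 v) \<cdot>\<^sub>v (M *\<^sub>v v)"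
    using assms by (intro mult_mat_vec[of M "dim_row M" "dim_col M"]) (auto intro: carrier_vecI carrier_matI)
  moreover have "vec_norm2 v > 0" using False by (simp add: less_le)
  ultimately show ?thesis by (simp add: norm_divide field_simps)
qed

lemma spec_norm_le:
  assumes "\<And>v. v \<in> carrier_vec (dim_col M) \<Longrightarrow> vec_norm2 (M *\<^sub>v v) \<le> C * vec_norm2 v" "0 \<le> C"
  shows "spec_norm M \<le> C"
  unfolding spec_norm_def
proof (rule cSup_least)
  show "{vec_norm2 (M *\<^sub>v v) | v. v \<in> carrier_vec (dim_col M) \<and> vec_norm2 v \<le> 1} \<noteq> {}"
    using zero_carrier_vec[of "dim_col M"] vec_norm2_zero zero_le_one by fastforce
next
  fix x assume "x \<in> {vec_norm2 (M *\<^sub>v v) | v. v \<in> carrier_vec (dim_col M) \<and> vec_norm2 v \<le> 1}"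
  then obtain v where v: "v \<in> carrier_vec (dim_col M)" "vec_norm2 v \<le> 1" "x = vec_norm2 (M *\<^sub>v v)" by auto
  show "x \<le> C" using assms(1)[OF v(1)] v(2,3) assms(2) mult_left_le[of "vec_norm2 v" C] by auto
qed

lemma spec_norm_mult:
  assumes "dim_col A = dim_row B"
  shows "spec_norm (A * B) \<le> spec_norm A * spec_norm B"
proof (rule spec_norm_le)
  fix v :: "complex vec" assume v: "v \<in> carrier_vec (dim_col (A * B))"
  have "vec_norm2 (A * B *\<^sub>v v) = vec_norm2 (A *\<^sub>v (B *\<^sub>v v))"
    using v assms by (subst mult_mat_vec_assoc_dim) auto
  also have "\<dots> \<le> spec_norm A * vec_norm2 (B *\<^sub>v v)" using assms by (intro spec_norm_bound) auto
  also have "\<dots> \<le> spec_norm A * (spec_norm B * vec_norm2 v)"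
    using v by (intro mult_left_mono spec_norm_bound) auto
  finally show "vec_norm2 (A * B *\<^sub>v v) \<le> spec_norm A * spec_norm B * vec_norm2 v" by (simp add: ac_simps)
qed simp

lemma spec_norm_add:
  assumes "dim_row A = dim_row B" "dim_col A = dim_col B"
  shows "spec_norm (A + B) \<le> spec_norm A + spec_norm B"
proof (rule spec_norm_le)
  fix v :: "complex vec" assume v: "v \<in> carrier_vec (dim_col (A + B))"
  have "(A + B) *\<^sub>v v = A *\<^sub>v v + B *\<^sub>v v"
    using v assms by (intro add_mult_distrib_mat_vec[of A "dim_row A" "dim_col A"]) (auto intro!: carrier_matI)
  then have "vec_norm2 ((A + B) *\<^sub>v v) \<le> vec_norm2 (A *\<^sub>v v) + vec_norm2 (B *\<^sub>v v)"
    using assms by (simp add: vec_norm2_add)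
  also have "\<dots> \<le> spec_norm A * vec_norm2 v + spec_norm B * vec_norm2 v"
    using v assms by (intro add_mono spec_norm_bound) auto
  finally show "vec_norm2 ((A + B) *\<^sub>v v) \<le> (spec_norm A + spec_norm B) * vec_norm2 v"
    by (simp add: algebra_simps)
qed simp

text \<open>
  With $z = M^* w$ one has $\|z\|^2 = \langle M z, w\rangle \le \|M\|\,\|z\|\,\|w\|$.
\<close>

lemma spec_norm_adjoint_le: "spec_norm (mat_adjoint M) \<le> spec_norm M"
proof (rule spec_norm_le)
  fix w :: "complex vec" assume "w \<in> carrier_vec (dim_col (mat_adjoint M))"
  then have w: "w \<in> carrier_vec (dim_row M)" by simp
  let ?z = "mat_adjoint M *\<^sub>v w"
  have z: "?z \<in> carrier_vec (dim_col M)" by (intro carrier_vecI) simp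
  have "complex_of_real ((vec_norm2 ?z)\<^sup>2) = (M *\<^sub>v ?z) \<bullet>c w"
    using cscalar_adjoint[OF carrier_matI[OF refl refl] z w] by (simp add: cscalar_self)
  then have "(vec_norm2 ?z)\<^sup>2 \<le> vec_norm2 (M *\<^sub>v ?z) * vec_norm2 w"
    using cauchy_schwarz_vec[of "M *\<^sub>v ?z" w] w
    by (metis abs_of_nonneg carrier_vecD dim_mult_mat_vec norm_of_real zero_le_power2)
  also have "\<dots> \<le> spec_norm M * vec_norm2 ?z * vec_norm2 w"
    by (intro mult_right_mono spec_norm_bound) auto
  finally have "vec_norm2 ?z * vec_norm2 ?z \<le> vec_norm2 ?z * (spec_norm M * vec_norm2 w)"
    by (simp add: power2_eq_square ac_simps)
  then show "vec_norm2 ?z \<le> spec_norm M * vec_norm2 w"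
    by (metis mult_le_cancel_left_pos mult_nonneg_nonneg spec_norm_nonneg vec_norm2_nonneg less_le)
qed simp

lemma spec_norm_one_le: "spec_norm (1\<^sub>m n) \<le> 1"
  by (rule spec_norm_le) auto

lemma spec_norm_le_entries: "spec_norm M \<le> (\<Sum>i<dim_row M. \<Sum>j<dim_col M. cmod (M $$ (i, j)))"
  by (rule spec_norm_le) (simp_all add: mult_vec_le_entry_sum sum_nonneg)

lemma entry_le_spec_norm:
  assumes "i < dim_row M" "j < dim_col M"
  shows "cmod (M $$ (i, j)) \<le> spec_norm M"
proof -
  have "M $$ (i, j) = (M *\<^sub>v unit_vec (dim_col M) j) $ i"
    using assms by (simp add: scalar_prod_right_unit[of _ "dim_col M"])
  also have "cmod \<dots> \<le> vec_norm2 (M *\<^sub>v unit_vec (dim_col M) j)"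
    unfolding vec_norm2_L2 by (rule member_le_L2_set) (use assms in auto)
  also have "\<dots> \<le> spec_norm M * vec_norm2 (unit_vec (dim_col M) j)"
    by (rule spec_norm_bound) simp
  also have "vec_norm2 (unit_vec (dim_col M) j) = 1"
    using assms by (simp add: vec_norm2_def unit_vec_def if_distrib[of "\<lambda>x. x\<^sup>2"] if_distrib[of cmod] cong: if_cong)
  finally show ?thesis by simp
qed

section \<open>Block diagonal matrices\<close>

lemma hat_0: "hat 0 Z = 0\<^sub>m 0 0"
  by (simp add: hat_def)

lemma hat_Suc:
  "hat (Suc m) Z = four_block_mat Z (0\<^sub>m (dim_row Z) (dim_col (hat m Z)))
     (0\<^sub>m (dim_row (hat m Z)) (dim_col Z)) (hat m Z)"
  by (simp add: hat_def Let_def)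

lemma dim_hat [simp]:
  "dim_row (hat m Z) = m * dim_row Z" "dim_col (hat m Z) = m * dim_col Z"
  by (simp_all add: hat_def dim_diag_block_mat map_replicate sum_list_replicate)

lemma hat_carrier [simp]: "Z \<in> carrier_mat r c \<Longrightarrow> hat m Z \<in> carrier_mat (m * r) (m * c)"
  by (intro carrier_matI) auto

lemma hat_mult:
  assumes "dim_col X = dim_row Y"
  shows "hat m (X * Y) = hat m X * hat m Y"
proof (induction m)
  case (Suc m)
  have "hat (Suc m) X * hat (Suc m) Y =
      four_block_mat (X * Y) (0\<^sub>m (dim_row X) (m * dim_col Y)) (0\<^sub>m (m * dim_row X) (dim_col Y)) (hat m X * hat m Y)"
    using assms
    by (subst hat_Suc, subst hat_Suc[of m Y],
        subst mult_four_block_mat[of _ "dim_row X" "dim_col X" _ "m * dim_col X" _ "m * dim_row X" _ _ "dim_col Y" _ "m * dim_col Y"])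
      (auto intro!: carrier_matI)
  then show ?case by (simp add: hat_Suc Suc)
qed (simp add: hat_0)

lemma hat_one: "hat m (1\<^sub>m n) = 1\<^sub>m (m * n)"
  by (induction m) (simp_all add: hat_0 hat_Suc, (rule eq_matI; auto))

lemma hat_zero: "hat m (0\<^sub>m n n) = 0\<^sub>m (m * n) (m * n)"
  by (induction m) (simp_all add: hat_0 hat_Suc)

lemma hat_minus:
  assumes "dim_row X = dim_row Y" "dim_col X = dim_col Y"
  shows "hat m (X - Y) = hat m X - hat m (Y :: complex mat)"
proof (induction m)
  case (Suc m)
  show ?case unfolding hat_Suc Suc
    by (rule eq_matI) (use assms in auto)
qed (rule eq_matI, auto simp: hat_0)

lemma hat_adjoint: "hat m (mat_adjoint X) = mat_adjoint (hat m X)"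
proof (induction m)
  case (Suc m)
  show ?case unfolding hat_Suc Suc
    by (rule eq_matI) auto
qed (rule eq_matI, auto simp: hat_0)

lemma vec_norm2_append: "(vec_norm2 (v @\<^sub>v w))\<^sup>2 = (vec_norm2 v)\<^sup>2 + (vec_norm2 w)\<^sup>2"
proof -
  have "complex_of_real ((vec_norm2 (v @\<^sub>v w))\<^sup>2) = (v @\<^sub>v w) \<bullet>c (v @\<^sub>v w)"
    by (simp only: cscalar_self)
  also have "conjugate (v @\<^sub>v w) = conjugate v @\<^sub>v conjugate w"
    by (rule eq_vecI) auto
  also have "(v @\<^sub>v w) \<bullet> (conjugate v @\<^sub>v conjugate w) = v \<bullet>c v + w \<bullet>c w"
    by (rule scalar_prod_append) (auto intro: carrier_vecI)
  finally show ?thesis unfolding cscalar_self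
    by (simp only: flip: of_real_add) (simp only: of_real_eq_iff)
qed

lemma hat_Suc_mult_append:
  assumes "Z \<in> carrier_mat n n" "v \<in> carrier_vec n" "w \<in> carrier_vec (m * n)"
  shows "hat (Suc m) Z *\<^sub>v (v @\<^sub>v w) = (Z *\<^sub>v v) @\<^sub>v (hat m Z *\<^sub>v w)"
  unfolding hat_Suc using assms hat_carrier[OF assms(1), of m]
  by (simp add: mult_mat_vec_split)

text \<open>
  The sign \<^term>\<open>s\<close> makes one induction serve for upper bounds (\<^term>\<open>s = 1\<close>) and for lower
  bounds (\<^term>\<open>s = -1\<close>) of the form of the block diagonal matrix.
\<close>

lemma hat_quadratic_form_le:
  assumes Z: "Z \<in> carrier_mat n n"
    and le: "\<And>v. v \<in> carrier_vec n \<Longrightarrow> s * Re ((Z *\<^sub>v v) \<bullet>c v) \<le> C * (vec_norm2 v)\<^sup>2"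
    and u: "u \<in> carrier_vec (m * n)"
  shows "s * Re ((hat m Z *\<^sub>v u) \<bullet>c u) \<le> C * (vec_norm2 u)\<^sup>2"
  using u
proof (induction m arbitrary: u)
  case 0
  then show ?case by (auto simp: hat_0 scalar_prod_def vec_norm2_def)
next
  case (Suc m)
  define v where "v = vec_first u n"
  define w where "w = vec_last u (m * n)"
  have u: "u = v @\<^sub>v w" and v: "v \<in> carrier_vec n" and w: "w \<in> carrier_vec (m * n)"
    using Suc.prems by (simp_all add: v_def w_def)
  have "conjugate (v @\<^sub>v w) = conjugate v @\<^sub>v conjugate w"
    by (rule eq_vecI) auto
  then have "(hat (Suc m) Z *\<^sub>v u) \<bullet>c u = (Z *\<^sub>v v) \<bullet>c v + (hat m Z *\<^sub>v w) \<bullet>c w"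
    unfolding u hat_Suc_mult_append[OF Z v w]
    using Z v w by (simp add: scalar_prod_append[of _ n _ "m * n"] carrier_vec_conjugate mult_mat_vec_carrier[of _ _ "m * n"])
  then show ?case
    using le[OF v] Suc.IH[OF w] by (simp add: u vec_norm2_append algebra_simps)
qed

lemma spec_norm_hat_le:
  assumes Z: "Z \<in> carrier_mat n n"
  shows "spec_norm (hat m Z) \<le> spec_norm Z"
proof (rule spec_norm_le)
  fix u :: "complex vec" assume "u \<in> carrier_vec (dim_col (hat m Z))"
  then have "u \<in> carrier_vec (m * n)" using Z by simp
  then have "(vec_norm2 (hat m Z *\<^sub>v u))\<^sup>2 \<le> (spec_norm Z * vec_norm2 u)\<^sup>2"
  proof (induction m arbitrary: u)
    case 0
    then show ?case by (auto simp: hat_0 vec_norm2_def)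
  next
    case (Suc m)
    define v where "v = vec_first u n"
    define w where "w = vec_last u (m * n)"
    have u: "u = v @\<^sub>v w" and v: "v \<in> carrier_vec n" and w: "w \<in> carrier_vec (m * n)"
      using Suc.prems by (simp_all add: v_def w_def)
    have "(vec_norm2 (Z *\<^sub>v v))\<^sup>2 \<le> (spec_norm Z * vec_norm2 v)\<^sup>2"
      using Z v by (intro power_mono spec_norm_bound) auto
    then show ?case
      unfolding u hat_Suc_mult_append[OF Z v w] using Suc.IH[OF w]
      by (simp add: vec_norm2_append power_mult_distrib algebra_simps)
  qed
  then show "vec_norm2 (hat m Z *\<^sub>v u) \<le> spec_norm Z * vec_norm2 u"
    by (rule power2_le_imp_le) simp
qed simp

section \<open>Inverses and positive definite matrices\<close>

lemma inv_mat_unique: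
  assumes "A \<in> carrier_mat n n" "B \<in> carrier_mat n n" "A * B = 1\<^sub>m n" "B * A = 1\<^sub>m n"
  shows "inv_mat A = B"
proof (cases "mat_inverse A")
  case None
  have "A \<in> Units (ring_mat TYPE(complex) n ())"
    using assms by (auto simp: Units_def ring_mat_def)
  then show ?thesis using mat_inverse(1)[OF assms(1) None, where b = "()"] by simp
next
  case (Some C)
  then have C: "C * A = 1\<^sub>m n" "C \<in> carrier_mat n n" using mat_inverse(2)[OF assms(1)] by auto
  have "C = C * (A * B)" using assms(3) C by simp
  also have "\<dots> = C * A * B" using assms(1,2) C(2) by (simp add: mult_assoc_dim)
  also have "\<dots> = B" using C assms by simp
  finally show ?thesis using Some by (simp add: inv_mat_def)
qed

lemma inv_mat_props:
  assumes "A \<in> carrier_mat n n" "invertible_mat A"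
  shows "inv_mat A \<in> carrier_mat n n" "A * inv_mat A = 1\<^sub>m n" "inv_mat A * A = 1\<^sub>m n"
proof -
  obtain B where B: "A * B = 1\<^sub>m (dim_row A)" "B * A = 1\<^sub>m (dim_row B)"
    using assms(2) by (auto simp: invertible_mat_def inverts_mat_def)
  have "dim_col (A * B) = n" "dim_col (B * A) = dim_row B" using B assms by auto
  then have Bc: "B \<in> carrier_mat n n" using assms by (intro carrier_matI) auto
  then have "inv_mat A = B" using inv_mat_unique[OF assms(1) Bc] B assms by auto
  then show "inv_mat A \<in> carrier_mat n n" "A * inv_mat A = 1\<^sub>m n" "inv_mat A * A = 1\<^sub>m n"
    using B Bc assms by auto
qed

lemma inv_mat_hat:
  assumes "A \<in> carrier_mat n n" "invertible_mat A"
  shows "inv_mat (hat m A) = hat m (inv_mat A)"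
  using inv_mat_props[OF assms] assms(1)
  by (intro inv_mat_unique[of _ "m * n"]) (auto simp: hat_one simp flip: hat_mult)

lemma pos_def_carrier: "pos_def n X \<Longrightarrow> X \<in> carrier_mat n n"
  by (simp add: pos_def_def hermitian_mat_def)

lemma pos_def_adjoint: "pos_def n X \<Longrightarrow> mat_adjoint X = X"
  by (simp add: pos_def_def hermitian_mat_def)

lemma pos_def_invertible:
  assumes "pos_def n X"
  shows "invertible_mat X"
proof -
  have X: "X \<in> carrier_mat n n" by (rule pos_def_carrier[OF assms])
  have "det X \<noteq> 0"
  proof
    assume "det X = 0"
    then obtain v where "v \<in> carrier_vec n" "v \<noteq> 0\<^sub>v n" "X *\<^sub>v v = 0\<^sub>v n"
      using det_0_iff_vec_prod_zero[OF X] by auto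
    then show False using assms by (auto simp: pos_def_def)
  qed
  then have "X \<in> Units (ring_mat TYPE(complex) n ())" by (rule det_non_zero_imp_unit[OF X])
  then obtain B where "B \<in> carrier_mat n n" "X * B = 1\<^sub>m n" "B * X = 1\<^sub>m n"
    by (auto simp: Units_def ring_mat_def)
  then show ?thesis using X by (auto simp: invertible_mat_def inverts_mat_def)
qed

lemmas pos_def_inv_props = inv_mat_props[OF pos_def_carrier pos_def_invertible]

lemma adjoint_inv_mat:
  assumes "pos_def n X"
  shows "mat_adjoint (inv_mat X) = inv_mat X"
proof -
  note P = pos_def_inv_props[OF assms assms] and X = pos_def_carrier[OF assms]
  have "mat_adjoint (X * inv_mat X) = 1\<^sub>m n" "mat_adjoint (inv_mat X * X) = 1\<^sub>m n"
    using P by auto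
  then have "X * mat_adjoint (inv_mat X) = 1\<^sub>m n" "mat_adjoint (inv_mat X) * X = 1\<^sub>m n"
    using P(1) X pos_def_adjoint[OF assms] by (auto simp: adjoint_mult)
  then show ?thesis using inv_mat_unique[OF X _, of "mat_adjoint (inv_mat X)"] P(1) by simp
qed

lemma inv_mat_form_nonneg:
  assumes "pos_def n X" "v \<in> carrier_vec n"
  shows "0 \<le> Re ((inv_mat X *\<^sub>v v) \<bullet>c v)"
proof -
  note P = pos_def_inv_props[OF assms(1) assms(1)] and X = pos_def_carrier[OF assms(1)]
  let ?w = "inv_mat X *\<^sub>v v"
  have w: "?w \<in> carrier_vec n" using P(1) by (intro carrier_vecI) simp
  have "v = X *\<^sub>v ?w" using P X assms(2) by (simp flip: mult_mat_vec_assoc_dim)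
  then have "?w \<bullet>c v = (X *\<^sub>v ?w) \<bullet>c ?w"
    using cscalar_adjoint[OF X w w] pos_def_adjoint[OF assms(1)] by simp
  moreover have "0 \<le> Re ((X *\<^sub>v ?w) \<bullet>c ?w)"
  proof (cases "?w = 0\<^sub>v n")
    case True
    then show ?thesis by (simp add: scalar_prod_def)
  next
    case False
    then show ?thesis using assms(1) w unfolding pos_def_def by (blast intro: less_imp_le)
  qed
  ultimately show ?thesis by simp
qed

section \<open>Unitarily invariant norms of adjoints\<close>

lemma exists_unitary_first_column:
  assumes v: "v \<in> carrier_vec n" "vec_norm2 v = 1"
  shows "\<exists>U. unitary_mat n U \<and> col U 0 = v"
proof -
  interpret cof_vec_space n "TYPE(complex)" .
  have v0: "v \<noteq> 0\<^sub>v n" using v by auto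
  define bs where "bs = basis_completion v"
  define ws where "ws = gram_schmidt n bs"
  note b = basis_completion[OF v(1) v0, folded bs_def]
  have n: "0 < n" using v0 v(1) by (cases n) auto
  obtain vs where bv: "bs = v # vs" using b(6,7) n by (cases bs) auto
  have ws: "corthogonal ws" "set ws \<subseteq> carrier_vec n" "length ws = n"
    using gram_schmidt_result[OF b(2,4,5) ws_def] b(6) by auto
  have hd: "ws ! 0 = v" using gram_schmidt_hd[OF v(1), of vs] ws(3) n
    by (simp add: ws_def bv hd_conv_nth flip: length_greater_0_conv)
  have wc: "ws ! i \<in> carrier_vec n" if "i < n" for i using ws that by auto
  \<comment> \<open>Gram-Schmidt keeps the first vector and makes the others orthogonal but not unit vectors.\<close>
  define nw where "nw i = complex_of_real (1 / vec_norm2 (ws ! i))" for i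
  define U where "U = mat n n (\<lambda>(i, j). nw j * ws ! j $ i)"
  have U: "U \<in> carrier_mat n n" by (simp add: U_def)
  have orth: "(\<Sum>k<n. ws ! j $ k * cnj (ws ! i $ k)) = (if i = j then complex_of_real ((vec_norm2 (ws ! i))\<^sup>2) else 0)"
    if "i < n" "j < n" for i j
  proof -
    have "(\<Sum>k<n. ws ! j $ k * cnj (ws ! i $ k)) = ws ! j \<bullet>c ws ! i"
      using carrier_vecD[OF wc] that by (simp add: scalar_prod_def atLeast0LessThan)
    then show ?thesis using corthogonalD[OF ws(1), of j i] that ws(3) by (auto simp: cscalar_self)
  qed
  have nz: "vec_norm2 (ws ! i) \<noteq> 0" if "i < n" for i
    using corthogonalD[OF ws(1), of i i] that ws(3) by (auto simp: cscalar_self)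
  have UU: "mat_adjoint U * U = 1\<^sub>m n"
  proof (rule eq_matI)
    fix i j assume "i < dim_row (1\<^sub>m n :: complex mat)" "j < dim_col (1\<^sub>m n :: complex mat)"
    then have ij: "i < n" "j < n" by auto
    have "(mat_adjoint U * U) $$ (i, j) = (\<Sum>k<n. cnj (nw i) * nw j * (ws ! j $ k * cnj (ws ! i $ k)))"
      using ij U by (auto simp: scalar_prod_def atLeast0LessThan U_def intro!: sum.cong)
    also have "\<dots> = cnj (nw i) * nw j * (if i = j then complex_of_real ((vec_norm2 (ws ! i))\<^sup>2) else 0)"
      using orth[OF ij] by (simp flip: sum_distrib_left)
    also have "\<dots> = 1\<^sub>m n $$ (i, j)"
      using nz[OF ij(1)] ij by (auto simp: nw_def power2_eq_square)
    finally show "(mat_adjoint U * U) $$ (i, j) = 1\<^sub>m n $$ (i, j)" .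
  qed (use U in auto)
  have "U * mat_adjoint U = 1\<^sub>m n"
    by (rule mat_mult_left_right_inverse[OF adjoint_carrier[OF U] U UU])
  moreover have "col U 0 = v"
    using n v by (intro eq_vecI) (auto simp: U_def nw_def hd)
  ultimately show ?thesis using UU U n by (auto simp: unitary_mat_def)
qed

lemma unitary_matD:
  assumes "unitary_mat n U"
  shows "U \<in> carrier_mat n n" "dim_row U = n" "dim_col U = n" "mat_adjoint U * U = 1\<^sub>m n" "U * mat_adjoint U = 1\<^sub>m n"
  using assms by (auto simp: unitary_mat_def)

lemma unitary_mat_mult:
  assumes "unitary_mat n U" "unitary_mat n V"
  shows "unitary_mat n (U * V)"
proof -
  note U = unitary_matD[OF assms(1)] and V = unitary_matD[OF assms(2)]
  have "mat_adjoint (U * V) * (U * V) = mat_adjoint V * ((mat_adjoint U * U) * V)"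
    using U(2,3) V(2,3) by (simp add: adjoint_mult mult_assoc_dim)
  moreover have "(U * V) * mat_adjoint (U * V) = U * ((V * mat_adjoint V) * mat_adjoint U)"
    using U(2,3) V(2,3) by (simp add: adjoint_mult mult_assoc_dim)
  moreover have "U * V \<in> carrier_mat n n" using U V by simp
  ultimately show ?thesis using U V by (simp add: unitary_mat_def)
qed

lemma unitary_mat_adjoint: "unitary_mat n U \<Longrightarrow> unitary_mat n (mat_adjoint U)"
  by (auto simp: unitary_mat_def)

lemma unitary_mat_one: "unitary_mat n (1\<^sub>m n)"
  by (auto simp: unitary_mat_def)

lemma exists_unit_kernel_vector:
  assumes M: "M \<in> carrier_mat n n" and "det M = (0 :: complex)"
  shows "\<exists>v \<in> carrier_vec n. vec_norm2 v = 1 \<and> M *\<^sub>v v = 0\<^sub>v n"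
proof -
  obtain v where v: "v \<in> carrier_vec n" "v \<noteq> 0\<^sub>v n" "M *\<^sub>v v = 0\<^sub>v n"
    using det_0_iff_vec_prod_zero[OF M] assms(2) by auto
  let ?a = "complex_of_real (1 / vec_norm2 v)"
  have "vec_norm2 v \<noteq> 0" using vec_norm2_eq_0 v by blast
  then have "vec_norm2 (?a \<cdot>\<^sub>v v) = 1" by (simp add: norm_divide)
  moreover have "M *\<^sub>v (?a \<cdot>\<^sub>v v) = 0\<^sub>v n" using mult_mat_vec[OF M v(1)] v(3) by auto
  ultimately show ?thesis using v(1) by (intro bexI[of _ "?a \<cdot>\<^sub>v v"]) auto
qed

text \<open>
  If $M$ is singular, then so is $M^*$, and unit vectors of the two kernels do for $s = 0$.
  Otherwise $v$ is a unit eigenvector of $M^* M$ and $u = Mv/\|Mv\|$; the eigenvalue is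
  $\|Mv\|^2$, hence positive.
\<close>

lemma exists_singular_pair:
  fixes M :: "complex mat"
  assumes M: "M \<in> carrier_mat n n" and n: "0 < n"
  shows "\<exists>u v. \<exists>s :: real. u \<in> carrier_vec n \<and> v \<in> carrier_vec n \<and> vec_norm2 u = 1 \<and> vec_norm2 v = 1 \<and>
    M *\<^sub>v v = complex_of_real s \<cdot>\<^sub>v u \<and> mat_adjoint M *\<^sub>v u = complex_of_real s \<cdot>\<^sub>v v"
proof (cases "det M = 0")
  case True
  have "det (mat_adjoint M) = 0"
  proof (rule ccontr)
    assume "det (mat_adjoint M) \<noteq> 0"
    then have "mat_adjoint M \<in> Units (ring_mat TYPE(complex) n ())"
      by (rule det_non_zero_imp_unit[OF adjoint_carrier[OF M]])
    then obtain B where B: "B \<in> carrier_mat n n" "B * mat_adjoint M = 1\<^sub>m n"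
      by (auto simp: Units_def ring_mat_def)
    have "mat_adjoint (B * mat_adjoint M) = M * mat_adjoint B"
      using B(1) M by (simp add: adjoint_mult)
    then have "M * mat_adjoint B = 1\<^sub>m n" using B(2) by simp
    then have "det M * det (mat_adjoint B) = 1"
      using det_mult[OF M adjoint_carrier[OF B(1)]] by simp
    then show False using True by simp
  qed
  then obtain u where "u \<in> carrier_vec n" "vec_norm2 u = 1" "mat_adjoint M *\<^sub>v u = 0\<^sub>v n"
    using exists_unit_kernel_vector[OF adjoint_carrier[OF M]] by blast
  moreover obtain v where "v \<in> carrier_vec n" "vec_norm2 v = 1" "M *\<^sub>v v = 0\<^sub>v n"
    using exists_unit_kernel_vector[OF M True] by blast
  ultimately show ?thesis by (intro exI[of _ u] exI[of _ v] exI[of _ 0]) auto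
next
  case False
  let ?H = "mat_adjoint M * M"
  have H: "?H \<in> carrier_mat n n" using M by auto
  obtain a where "a \<in> spectrum ?H" using spectrum_non_empty[OF H n] by auto
  then obtain w where "eigenvector ?H w a" by (auto simp: spectrum_def eigenvalue_def)
  then have w: "w \<in> carrier_vec n" "w \<noteq> 0\<^sub>v n" "?H *\<^sub>v w = a \<cdot>\<^sub>v w"
    using M by (auto simp: eigenvector_def)
  define v where "v = complex_of_real (1 / vec_norm2 w) \<cdot>\<^sub>v w"
  have "vec_norm2 w \<noteq> 0" using vec_norm2_eq_0 w by blast
  then have v1: "vec_norm2 v = 1" by (simp add: v_def norm_divide)
  have v: "v \<in> carrier_vec n" using w by (simp add: v_def)
  have "?H *\<^sub>v v = a \<cdot>\<^sub>v v"
    using mult_mat_vec[OF H w(1)] w(3) by (simp add: v_def smult_smult_assoc mult.commute)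
  then have Hv: "mat_adjoint M *\<^sub>v (M *\<^sub>v v) = a \<cdot>\<^sub>v v"
    using M v by (simp add: mult_mat_vec_assoc_dim)
  have Mv: "M *\<^sub>v v \<in> carrier_vec n" using M v by auto
  define s where "s = vec_norm2 (M *\<^sub>v v)"
  have "v \<noteq> 0\<^sub>v n" using v1 by auto
  then have "M *\<^sub>v v \<noteq> 0\<^sub>v n" using False det_0_iff_vec_prod_zero[OF M] v by auto
  then have s: "s \<noteq> 0" using vec_norm2_eq_0[OF Mv] by (simp add: s_def)
  have "complex_of_real (s\<^sup>2) = v \<bullet>c (a \<cdot>\<^sub>v v)"
    using cscalar_adjoint[OF M v Mv] Hv by (simp only: cscalar_self s_def)
  also have "\<dots> = cnj a" using v1 v by (simp add: conjugate_smult_vec cscalar_self)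
  finally have a: "a = complex_of_real (s\<^sup>2)" by (metis complex_cnj_cnj complex_cnj_complex_of_real)
  define u where "u = complex_of_real (1 / s) \<cdot>\<^sub>v (M *\<^sub>v v)"
  have "u \<in> carrier_vec n" using Mv by (simp add: u_def)
  moreover have "vec_norm2 u = 1" using s by (simp add: u_def norm_divide) (simp add: s_def)
  moreover have "M *\<^sub>v v = complex_of_real s \<cdot>\<^sub>v u" using s by (simp add: u_def smult_smult_assoc)
  moreover have "mat_adjoint M *\<^sub>v u = complex_of_real s \<cdot>\<^sub>v v"
    using mult_mat_vec[OF adjoint_carrier[OF M] Mv] Hv a s
    by (simp add: u_def smult_smult_assoc power2_eq_square)
  ultimately show ?thesis using v v1 by blast
qed

text \<open>
  A form of the polar decomposition, by induction on the size. A singular pair $u$, $v$ with value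
  $s$ is extended to unitary matrices $U$, $V$ that have $u$ and $v$ as first columns. Since
  $Mv = su$ and $M^*u = sv$, the first column and the first row of $U^* M V$ vanish off the
  diagonal, and what remains is a smaller block, to which the induction hypothesis applies.
\<close>

lemma exists_unitary_hermitian_mult:
  fixes M :: "complex mat"
  assumes "M \<in> carrier_mat n n"
  shows "\<exists>W. unitary_mat n W \<and> mat_adjoint (W * M) = W * M"
  using assms
proof (induction n arbitrary: M)
  case 0
  then show ?case by (intro exI[of _ "1\<^sub>m 0"] conjI unitary_mat_one) (rule eq_matI, auto)
next
  case (Suc n)
  note M = Suc.prems
  obtain u v and s :: real where uv: "u \<in> carrier_vec (Suc n)" "v \<in> carrier_vec (Suc n)"
      "vec_norm2 u = 1" "vec_norm2 v = 1"
      "M *\<^sub>v v = complex_of_real s \<cdot>\<^sub>v u" "mat_adjoint M *\<^sub>v u = complex_of_real s \<cdot>\<^sub>v v"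
    using exists_singular_pair[OF M] by auto
  obtain U where U: "unitary_mat (Suc n) U" "col U 0 = u"
    using exists_unitary_first_column[OF uv(1,3)] by auto
  obtain V where V: "unitary_mat (Suc n) V" "col V 0 = v"
    using exists_unitary_first_column[OF uv(2,4)] by auto
  note U' = unitary_matD[OF U(1)] and V' = unitary_matD[OF V(1)]
  define R where "R = mat_adjoint U * M * V"
  have R: "R \<in> carrier_mat (Suc n) (Suc n)" using U' V' M by (auto simp: R_def)
  have adjR: "mat_adjoint R = mat_adjoint V * (mat_adjoint M * U)"
    using U' V' M by (simp add: R_def adjoint_mult mult_assoc_dim)
  have col0: "R $$ (i, 0) = (if i = 0 then complex_of_real s else 0)" if i: "i < Suc n" for i
  proof -
    have "R $$ (i, 0) = col (mat_adjoint U * (M * V)) 0 $ i"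
      using i R U' V' M by (simp add: R_def mult_assoc_dim)
    also have "col (mat_adjoint U * (M * V)) 0 = mat_adjoint U *\<^sub>v (M *\<^sub>v col V 0)"
      by (simp only: col_mult2[OF adjoint_carrier[OF U'(1)] mult_carrier_mat[OF M V'(1)] zero_less_Suc]
          col_mult2[OF M V'(1) zero_less_Suc])
    also have "M *\<^sub>v col V 0 = complex_of_real s \<cdot>\<^sub>v col U 0" using uv U V by simp
    also have "mat_adjoint U *\<^sub>v (complex_of_real s \<cdot>\<^sub>v col U 0) = complex_of_real s \<cdot>\<^sub>v col (mat_adjoint U * U) 0"
      using mult_mat_vec[of "mat_adjoint U" "Suc n" "Suc n" "col U 0"]
        col_mult2[of "mat_adjoint U" "Suc n" "Suc n" U "Suc n" 0] U'(1) uv(1) U(2) by simp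
    finally show ?thesis using i U' by simp
  qed
  have row0: "R $$ (0, j) = (if j = 0 then complex_of_real s else 0)" if j: "j < Suc n" for j
  proof -
    have "cnj (R $$ (0, j)) = mat_adjoint R $$ (j, 0)" using R j by simp
    also have "\<dots> = col (mat_adjoint V * (mat_adjoint M * U)) 0 $ j"
      using j R U' V' M by (simp add: adjR)
    also have "col (mat_adjoint V * (mat_adjoint M * U)) 0 = mat_adjoint V *\<^sub>v (mat_adjoint M *\<^sub>v col U 0)"
      by (simp only: col_mult2[OF adjoint_carrier[OF V'(1)] mult_carrier_mat[OF adjoint_carrier[OF M] U'(1)] zero_less_Suc]
          col_mult2[OF adjoint_carrier[OF M] U'(1) zero_less_Suc])
    also have "mat_adjoint M *\<^sub>v col U 0 = complex_of_real s \<cdot>\<^sub>v col V 0" using uv U V by simp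
    also have "mat_adjoint V *\<^sub>v (complex_of_real s \<cdot>\<^sub>v col V 0) = complex_of_real s \<cdot>\<^sub>v col (mat_adjoint V * V) 0"
      using mult_mat_vec[of "mat_adjoint V" "Suc n" "Suc n" "col V 0"]
        col_mult2[of "mat_adjoint V" "Suc n" "Suc n" V "Suc n" 0] V'(1) uv(2) V(2) by simp
    finally have "cnj (R $$ (0, j)) = (if j = 0 then complex_of_real s else 0)" using j V' by simp
    then show ?thesis by (metis complex_cnj_cnj complex_cnj_complex_of_real complex_cnj_zero)
  qed
  define S where "S = mat n n (\<lambda>(i, j). R $$ (Suc i, Suc j))"
  have S: "S \<in> carrier_mat n n" by (simp add: S_def)
  let ?s = "mat 1 1 (\<lambda>_. complex_of_real s)"
  have Rblock: "R = four_block_mat ?s (0\<^sub>m 1 n) (0\<^sub>m n 1) S"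
    by (rule eq_matI) (use R col0 row0 in \<open>auto simp: S_def\<close>)
  obtain W where W: "unitary_mat n W" "mat_adjoint (W * S) = W * S"
    using Suc.IH[OF S] by auto
  note W' = unitary_matD[OF W(1)]
  \<comment> \<open>The unitary matrix for the block is bordered by 1 and carried back to the original bases: $V T U^*$ works,
    because $V T U^* M = V (T R) V^*$ is unitarily similar to the Hermitian matrix $T R$.\<close>
  define T where "T = four_block_mat (1\<^sub>m 1) (0\<^sub>m 1 n) (0\<^sub>m n 1) W"
  have T: "T \<in> carrier_mat (Suc n) (Suc n)" using W' by (auto simp: T_def intro!: carrier_matI)
  have adjT: "mat_adjoint T = four_block_mat (1\<^sub>m 1) (0\<^sub>m 1 n) (0\<^sub>m n 1) (mat_adjoint W)"
    using W' by (intro eq_matI) (auto simp: T_def)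
  have block_mult: "four_block_mat X (0\<^sub>m 1 n) (0\<^sub>m n 1) Y * four_block_mat X' (0\<^sub>m 1 n) (0\<^sub>m n 1) Y' =
      four_block_mat (X * X') (0\<^sub>m 1 n) (0\<^sub>m n 1) (Y * Y')"
    if "X \<in> carrier_mat 1 1" "X' \<in> carrier_mat 1 1" "Y \<in> carrier_mat n n" "Y' \<in> carrier_mat n n"
    for X X' Y Y' :: "complex mat"
    using that by (subst mult_four_block_mat[of _ 1 1 _ n _ n _ _ 1 _ n]) auto
  have "mat_adjoint T * T = 1\<^sub>m (1 + n)"
    unfolding adjT unfolding T_def four_block_one_mat[symmetric]
    by (subst block_mult) (use W' in auto)
  moreover have "T * mat_adjoint T = 1\<^sub>m (1 + n)"
    unfolding adjT unfolding T_def four_block_one_mat[symmetric]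
    by (subst block_mult) (use W' in auto)
  ultimately have Tu: "unitary_mat (Suc n) T" using T by (simp add: unitary_mat_def)
  have TR: "T * R = four_block_mat ?s (0\<^sub>m 1 n) (0\<^sub>m n 1) (W * S)"
    unfolding T_def Rblock using W' S by (subst block_mult) auto
  have TRherm: "mat_adjoint (T * R) = T * R"
  proof -
    have "mat_adjoint (four_block_mat ?s (0\<^sub>m 1 n) (0\<^sub>m n 1) Y) =
        four_block_mat ?s (0\<^sub>m 1 n) (0\<^sub>m n 1) (mat_adjoint Y)" if "Y \<in> carrier_mat n n" for Y
      using that by (intro eq_matI) auto
    then show ?thesis using W(2) W' S by (simp only: TR mult_carrier_mat)
  qed
  let ?W = "V * (T * mat_adjoint U)"
  have "unitary_mat (Suc n) ?W"
    by (intro unitary_mat_mult unitary_mat_adjoint V U Tu)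
  moreover have WM: "?W * M = V * (T * R) * mat_adjoint V"
  proof -
    have "V * (T * R) * mat_adjoint V = V * (T * (mat_adjoint U * (M * (V * mat_adjoint V))))"
      using U'(2,3) V'(2,3) T M by (simp add: R_def mult_assoc_dim)
    then show ?thesis using U'(2,3) V'(2,3,5) T M by (simp add: mult_assoc_dim)
  qed
  moreover have "mat_adjoint (V * (T * R) * mat_adjoint V) = V * (mat_adjoint (T * R) * mat_adjoint V)"
    using U' V' T R by (subst adjoint_mult; simp add: adjoint_mult[of V])
  then have "mat_adjoint (V * (T * R) * mat_adjoint V) = V * (T * R) * mat_adjoint V"
    unfolding TRherm using V' T R by (simp add: mult_assoc_dim)
  ultimately show ?case by (intro exI[of _ ?W]) simp
qed

text \<open>
  If $WM$ is Hermitian, then $W M W = M^* W^* W = M^*$. Thus a matrix and its adjoint are unitarily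
  equivalent, and a unitarily invariant norm does not distinguish them.
\<close>

lemma exists_unitary_adjoint_eq:
  fixes M :: "complex mat"
  assumes M: "M \<in> carrier_mat n n"
  shows "\<exists>W. unitary_mat n W \<and> mat_adjoint M = W * M * W"
proof -
  obtain W where W: "unitary_mat n W" "mat_adjoint (W * M) = W * M"
    using exists_unitary_hermitian_mult[OF M] by auto
  note W' = unitary_matD[OF W(1)]
  have "W * M * W = mat_adjoint M * (mat_adjoint W * W)"
    using W(2)[symmetric] W'(2,3) M by (simp add: adjoint_mult mult_assoc_dim)
  then show ?thesis using W(1) W'(4) M by auto
qed

section \<open>Norms of products and of block diagonal matrices\<close>

lemma uinv_normD:
  assumes "unitarily_invariant_norm N"
  shows "X \<in> carrier_mat r c \<Longrightarrow> 0 \<le> N X"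
    and "X \<in> carrier_mat r c \<Longrightarrow> N X = 0 \<longleftrightarrow> X = 0\<^sub>m r c"
    and "X \<in> carrier_mat r c \<Longrightarrow> N (a \<cdot>\<^sub>m X) = cmod a * N X"
    and "X \<in> carrier_mat r c \<Longrightarrow> Y \<in> carrier_mat r c \<Longrightarrow> N (X + Y) \<le> N X + N Y"
    and "X \<in> carrier_mat r c \<Longrightarrow> spec_norm X \<le> N X"
    and "X \<in> carrier_mat p q \<Longrightarrow> Y \<in> carrier_mat q r \<Longrightarrow> Z \<in> carrier_mat r s \<Longrightarrow>
      N (X * Y * Z) \<le> spec_norm X * N Y * spec_norm Z"
proof -
  note a = assms[unfolded unitarily_invariant_norm_def]
  show "X \<in> carrier_mat r c \<Longrightarrow> 0 \<le> N X" "X \<in> carrier_mat r c \<Longrightarrow> N X = 0 \<longleftrightarrow> X = 0\<^sub>m r c"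
    using a[THEN conjunct1] by blast+
  note a = a[THEN conjunct2]
  show "X \<in> carrier_mat r c \<Longrightarrow> N (a \<cdot>\<^sub>m X) = cmod a * N X"
    using a[THEN conjunct1] by blast
  note a = a[THEN conjunct2]
  show "X \<in> carrier_mat r c \<Longrightarrow> Y \<in> carrier_mat r c \<Longrightarrow> N (X + Y) \<le> N X + N Y"
    using a[THEN conjunct1] by blast
  note a = a[THEN conjunct2, THEN conjunct2]
  show "X \<in> carrier_mat r c \<Longrightarrow> spec_norm X \<le> N X"
    using a[THEN conjunct1] by blast
  show "X \<in> carrier_mat p q \<Longrightarrow> Y \<in> carrier_mat q r \<Longrightarrow> Z \<in> carrier_mat r s \<Longrightarrow>
      N (X * Y * Z) \<le> spec_norm X * N Y * spec_norm Z"
    using a[THEN conjunct2] by blast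
qed

lemma uinv_norm_minus:
  assumes N: "unitarily_invariant_norm N" and X: "X \<in> carrier_mat r c" and Y: "Y \<in> carrier_mat r c"
  shows "N (X - Y) \<le> N X + N Y"
proof -
  have "X - Y = X + (-1) \<cdot>\<^sub>m Y" using X Y by (intro eq_matI) auto
  moreover have "N ((-1) \<cdot>\<^sub>m Y) = N Y" using uinv_normD(3)[OF N Y] by simp
  ultimately show ?thesis using uinv_normD(4)[OF N X, of "(-1) \<cdot>\<^sub>m Y"] Y by simp
qed

text \<open>
  The outer factors of the defining inequality can be identity matrices. In particular the norm is
  dominated by a multiple of the spectral norm, through \<^term>\<open>N (M * 1\<^sub>m n)\<close>.
\<close>

lemma uinv_norm_mult:
  assumes N: "unitarily_invariant_norm N" and X: "X \<in> carrier_mat p q" and Y: "Y \<in> carrier_mat q r"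
  shows "N (X * Y) \<le> spec_norm X * N Y" "N (X * Y) \<le> N X * spec_norm Y"
proof -
  have "N (X * Y * 1\<^sub>m r) \<le> spec_norm X * N Y * spec_norm (1\<^sub>m r)"
    by (rule uinv_normD(6)[OF N X Y one_carrier_mat])
  also have "\<dots> \<le> spec_norm X * N Y * 1"
    by (intro mult_left_mono spec_norm_one_le mult_nonneg_nonneg spec_norm_nonneg uinv_normD(1)[OF N Y])
  finally show "N (X * Y) \<le> spec_norm X * N Y" using X Y by simp
  have "N (1\<^sub>m p * X * Y) \<le> spec_norm (1\<^sub>m p) * N X * spec_norm Y"
    by (rule uinv_normD(6)[OF N one_carrier_mat X Y])
  also have "\<dots> \<le> 1 * N X * spec_norm Y"
    by (intro mult_right_mono spec_norm_one_le spec_norm_nonneg uinv_normD(1)[OF N X])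
  finally show "N (X * Y) \<le> N X * spec_norm Y" using X Y by simp
qed

lemma uinv_norm_adjoint_le:
  assumes N: "unitarily_invariant_norm N" and M: "M \<in> carrier_mat n n"
  shows "N (mat_adjoint M) \<le> N M"
proof -
  obtain W where W: "unitary_mat n W" "mat_adjoint M = W * M * W"
    using exists_unitary_adjoint_eq[OF M] by auto
  then show ?thesis using N M unfolding unitarily_invariant_norm_def by (metis order_refl)
qed

text \<open>
  The identity matrix of size $n$ is a corner of the one of size $mn$: cutting it out multiplies
  with the contractions $E = (I\; 0)$ and $E^*$, which cannot increase the norm. The
  consequence of interest is that $K_U$ is at least the spectral norm of $\widehat{X_L^{-1}}A$.
\<close>

lemma one_le_theta:
  assumes N: "unitarily_invariant_norm N" and th: "is_theta N n m \<theta>" and "0 < n" "0 < m"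
  shows "1 \<le> \<theta>"
proof -
  have ne: "1\<^sub>m n \<noteq> (0\<^sub>m n n :: complex mat)"
  proof
    assume "1\<^sub>m n = (0\<^sub>m n n :: complex mat)"
    then have "1\<^sub>m n $$ (0, 0) = (0\<^sub>m n n :: complex mat) $$ (0, 0)" by simp
    then show False using \<open>0 < n\<close> by simp
  qed
  then have \<theta>: "\<theta> = N (1\<^sub>m (m * n)) / N (1\<^sub>m n)"
    using th unfolding is_theta_def by (metis hat_one one_carrier_mat)
  define E where "E = mat n (m * n) (\<lambda>(i, j). if i = j then 1 else 0 :: complex)"
  have E: "E \<in> carrier_mat n (m * n)" by (simp add: E_def)
  have nm: "n \<le> m * n" using \<open>0 < m\<close> by simp
  have spec: "spec_norm E \<le> 1"
  proof (rule spec_norm_le)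
    fix v :: "complex vec" assume "v \<in> carrier_vec (dim_col E)"
    then have v: "v \<in> carrier_vec (m * n)" using E by simp
    have Ev: "(E *\<^sub>v v) $ i = v $ i" if "i < n" for i
    proof -
      have "(E *\<^sub>v v) $ i = (\<Sum>j<m * n. if i = j then v $ j else 0)"
        using that v by (auto simp: E_def scalar_prod_def atLeast0LessThan if_distrib[of "\<lambda>x. x * _"] cong: if_cong)
      also have "\<dots> = v $ i" using less_le_trans[OF that nm] by (subst sum.delta') auto
      finally show ?thesis .
    qed
    have "(\<Sum>i<n. (cmod ((E *\<^sub>v v) $ i))\<^sup>2) = (\<Sum>i<n. (cmod (v $ i))\<^sup>2)"
      by (rule sum.cong) (auto simp: Ev)
    also have "\<dots> \<le> (\<Sum>i<m * n. (cmod (v $ i))\<^sup>2)" using nm by (intro sum_mono2) auto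
    finally show "vec_norm2 (E *\<^sub>v v) \<le> 1 * vec_norm2 v"
      using E v by (simp add: vec_norm2_def)
  qed simp
  have "E * 1\<^sub>m (m * n) * mat_adjoint E = 1\<^sub>m n"
  proof (rule eq_matI)
    fix i j assume "i < dim_row (1\<^sub>m n :: complex mat)" "j < dim_col (1\<^sub>m n :: complex mat)"
    then have ij: "i < n" "j < n" by auto
    have "(E * mat_adjoint E) $$ (i, j) = (\<Sum>k<m * n. if i = k then (if j = k then 1 else 0) else 0)"
      using ij by (simp add: E_def scalar_prod_def atLeast0LessThan del: sum.delta sum.delta') (intro sum.cong; simp)
    also have "\<dots> = (if i = j then 1 else 0)" using ij less_le_trans[OF ij(1) nm] by auto
    finally show "(E * 1\<^sub>m (m * n) * mat_adjoint E) $$ (i, j) = 1\<^sub>m n $$ (i, j)" using ij E by auto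
  qed (use E in auto)
  then have "N (1\<^sub>m n) \<le> spec_norm E * N (1\<^sub>m (m * n)) * spec_norm (mat_adjoint E)"
    using uinv_normD(6)[OF N E one_carrier_mat adjoint_carrier[OF E]] by simp
  also have "\<dots> \<le> 1 * N (1\<^sub>m (m * n)) * 1"
    by (intro mult_mono spec order_trans[OF spec_norm_adjoint_le spec] mult_nonneg_nonneg spec_norm_nonneg)
      (auto intro: uinv_normD(1)[OF N one_carrier_mat])
  finally have "N (1\<^sub>m n) \<le> N (1\<^sub>m (m * n))" by simp
  moreover have "0 < N (1\<^sub>m n)"
    using uinv_normD(1,2)[OF N one_carrier_mat[of n]] ne by (simp add: less_le)
  ultimately show ?thesis by (simp add: \<theta>)
qed

lemma norm_hat_le_theta:
  assumes N: "unitarily_invariant_norm N" and th: "is_theta N n m \<theta>" and Z: "Z \<in> carrier_mat n n"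
  shows "N (hat m Z) \<le> \<theta> * N Z"
proof (cases "Z = 0\<^sub>m n n")
  case True
  then show ?thesis using uinv_normD(2)[OF N zero_carrier_mat] by (simp add: hat_zero)
next
  case False
  then have "\<theta> = N (hat m Z) / N Z" "N Z \<noteq> 0"
    using th Z uinv_normD(2)[OF N Z] by (auto simp: is_theta_def)
  then show ?thesis by simp
qed

section \<open>Contractions in the spectral norm\<close>

lemma spec_norm_eq_0_imp:
  assumes "M \<in> carrier_mat r c" "spec_norm M \<le> 0"
  shows "M = 0\<^sub>m r c"
proof (rule eq_matI)
  fix i j assume "i < dim_row (0\<^sub>m r c :: complex mat)" "j < dim_col (0\<^sub>m r c :: complex mat)"
  then have "cmod (M $$ (i, j)) \<le> 0" "i < r" "j < c"
    using entry_le_spec_norm[of i M j] assms by (auto simp del: norm_le_zero_iff intro: order_trans)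
  then show "M $$ (i, j) = 0\<^sub>m r c $$ (i, j)" using order_antisym[OF _ norm_ge_zero] by fastforce
qed (use assms in auto)

lemma spec_norm_minus_triangle:
  assumes "X \<in> carrier_mat r c" "Y \<in> carrier_mat r c" "Z \<in> carrier_mat r c"
  shows "spec_norm (X - Z) \<le> spec_norm (X - Y) + spec_norm (Y - Z)"
proof -
  have "X - Z = (X - Y) + (Y - Z)" using assms by (intro eq_matI) auto
  then show ?thesis using spec_norm_add[of "X - Y" "Y - Z"] assms by simp
qed

lemma spec_norm_minus_commute:
  assumes "X \<in> carrier_mat r c" "Y \<in> carrier_mat r c"
  shows "spec_norm (X - Y) = spec_norm (Y - X)"
proof -
  have "vec_norm2 ((X - Y) *\<^sub>v v) = vec_norm2 ((Y - X) *\<^sub>v v)" if "v \<in> carrier_vec c" for v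
  proof -
    have "(X - Y) *\<^sub>v v = (-1) \<cdot>\<^sub>v ((Y - X) *\<^sub>v v)"
      using assms that by (intro eq_vecI) (auto simp: scalar_prod_def algebra_simps sum_subtractf)
    then show ?thesis by simp
  qed
  then have "spec_norm (X - Y) \<le> spec_norm (Y - X)" "spec_norm (Y - X) \<le> spec_norm (X - Y)"
    using assms by (auto intro!: spec_norm_le) (metis carrier_matD(2) carrier_vecD index_minus_mat(3) spec_norm_bound)+
  then show ?thesis by simp
qed

text \<open>
  Banach's fixed point theorem for matrices of a size that is a variable. Successive iterates
  differ by a geometric sequence in every entry; the entrywise limit is also the limit in the
  spectral norm.
\<close>

lemma matrix_contraction_fixpoint:
  fixes C :: "complex mat set" and \<Phi> :: "complex mat \<Rightarrow> complex mat"
  assumes C: "C \<subseteq> carrier_mat n n"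
    and closed: "\<And>x X. (\<And>k. x k \<in> C) \<Longrightarrow> X \<in> carrier_mat n n \<Longrightarrow> (\<lambda>k. spec_norm (x k - X)) \<longlonglongrightarrow> 0 \<Longrightarrow> X \<in> C"
    and maps: "\<And>X. X \<in> C \<Longrightarrow> \<Phi> X \<in> C"
    and contr: "\<And>X Y. X \<in> C \<Longrightarrow> Y \<in> C \<Longrightarrow> spec_norm (\<Phi> X - \<Phi> Y) \<le> r * spec_norm (X - Y)"
    and r: "0 \<le> r" "r < 1" and x0: "x0 \<in> C"
  shows "\<exists>X \<in> C. \<Phi> X = X"
proof -
  define x where "x k = (\<Phi> ^^ k) x0" for k
  have xS: "x (Suc k) = \<Phi> (x k)" for k by (simp add: x_def)
  have xC: "x k \<in> C" for k by (induction k) (auto simp: xS maps, simp add: x_def x0)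
  have xc: "x k \<in> carrier_mat n n" for k using xC C by auto
  have step: "spec_norm (x (Suc k) - x k) \<le> r ^ k * spec_norm (x 1 - x 0)" for k
  proof (induction k)
    case (Suc k)
    have "spec_norm (x (Suc (Suc k)) - x (Suc k)) \<le> r * spec_norm (x (Suc k) - x k)"
      unfolding xS using contr[OF maps[OF xC] xC, of k k] xC by (simp add: xS)
    also have "\<dots> \<le> r * (r ^ k * spec_norm (x 1 - x 0))" using Suc r by (intro mult_left_mono)
    finally show ?case by simp
  qed simp
  have "convergent (\<lambda>k. x k $$ (i, j))" if ij: "i < n" "j < n" for i j
  proof -
    have le: "norm (x (Suc k) $$ (i, j) - x k $$ (i, j)) \<le> r ^ k * spec_norm (x 1 - x 0)" for k
      using entry_le_spec_norm[of i "x (Suc k) - x k" j] step[of k] xc[of k] xc[of "Suc k"] ij by simp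
    have "summable (\<lambda>k. r ^ k * spec_norm (x 1 - x 0))"
      using r by (intro summable_mult2 summable_geometric) simp
    then have "summable (\<lambda>k. x (Suc k) $$ (i, j) - x k $$ (i, j))"
      by (rule summable_comparison_test'[where N = 0]) (rule le)
    then have "convergent (\<lambda>k. \<Sum>l<k. x (Suc l) $$ (i, j) - x l $$ (i, j))"
      by (simp add: summable_iff_convergent)
    then have "convergent (\<lambda>k. x k $$ (i, j) - x 0 $$ (i, j))"
      by (simp only: sum_lessThan_telescope[of "\<lambda>k. x k $$ (i, j)"])
    then show ?thesis by (simp add: convergent_diff_const_right_iff)
  qed
  then have lim: "(\<lambda>k. x k $$ (i, j)) \<longlonglongrightarrow> lim (\<lambda>k. x k $$ (i, j))" if "i < n" "j < n" for i j
    using that convergent_LIMSEQ_iff by blast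
  define X where "X = mat n n (\<lambda>(i, j). lim (\<lambda>k. x k $$ (i, j)))"
  have X: "X \<in> carrier_mat n n" by (simp add: X_def)
  have conv: "(\<lambda>k. spec_norm (x k - X)) \<longlonglongrightarrow> 0"
  proof (rule tendsto_sandwich[OF _ _ tendsto_const])
    show "\<forall>\<^sub>F k in sequentially. spec_norm (x k - X) \<le> (\<Sum>i<n. \<Sum>j<n. cmod (x k $$ (i, j) - X $$ (i, j)))"
    proof (intro always_eventually allI)
      fix k
      have "spec_norm (x k - X) \<le> (\<Sum>i<n. \<Sum>j<n. cmod ((x k - X) $$ (i, j)))"
        using spec_norm_le_entries[of "x k - X"] X xc[of k] by simp
      also have "\<dots> = (\<Sum>i<n. \<Sum>j<n. cmod (x k $$ (i, j) - X $$ (i, j)))"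
        using X xc[of k] by (intro sum.cong) auto
      finally show "spec_norm (x k - X) \<le> (\<Sum>i<n. \<Sum>j<n. cmod (x k $$ (i, j) - X $$ (i, j)))" .
    qed
    have "(\<lambda>k. \<Sum>i<n. \<Sum>j<n. cmod (x k $$ (i, j) - X $$ (i, j))) \<longlonglongrightarrow> (\<Sum>i<n. \<Sum>j<n. 0)"
      by (intro tendsto_sum tendsto_norm_zero LIM_zero) (simp add: X_def lim)
    then show "(\<lambda>k. \<Sum>i<n. \<Sum>j<n. cmod (x k $$ (i, j) - X $$ (i, j))) \<longlonglongrightarrow> 0" by simp
  qed simp
  then have XC: "X \<in> C" using closed xC X by blast
  have FX: "\<Phi> X \<in> carrier_mat n n" using maps[OF XC] C by auto
  have "spec_norm (\<Phi> X - X) \<le> r * spec_norm (x k - X) + spec_norm (x (Suc k) - X)" for k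
    using spec_norm_minus_triangle[OF FX xc[of "Suc k"] X] contr[OF XC xC, of k]
      spec_norm_minus_commute[OF X xc, of k] by (simp add: xS)
  moreover have "(\<lambda>k. r * spec_norm (x k - X) + spec_norm (x (Suc k) - X)) \<longlonglongrightarrow> r * 0 + 0"
    by (intro tendsto_intros conv LIMSEQ_Suc[OF conv])
  ultimately have "spec_norm (\<Phi> X - X) \<le> 0"
    by (intro LIMSEQ_le_const[of _ 0]) auto
  then have zero: "\<Phi> X - X = 0\<^sub>m n n" by (rule spec_norm_eq_0_imp[OF minus_carrier_mat[OF X]])
  have "\<Phi> X = (\<Phi> X - X) + X" using FX X by (intro eq_matI) auto
  also have "\<dots> = X" unfolding zero using X by simp
  finally have "\<Phi> X = X" .
  then show ?thesis using XC by blast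
qed

section \<open>Perturbation of a positive definite matrix\<close>

lemma cscalar_add:
  fixes v w z :: "complex vec"
  assumes "dim_vec v = dim_vec z" "dim_vec w = dim_vec z"
  shows "(v + w) \<bullet>c z = v \<bullet>c z + w \<bullet>c z" "z \<bullet>c (v + w) = z \<bullet>c v + z \<bullet>c w"
  using assms by (simp_all add: scalar_prod_def algebra_simps sum.distrib)

lemma cscalar_smult:
  fixes v z :: "complex vec"
  assumes "dim_vec v = dim_vec z"
  shows "(a \<cdot>\<^sub>v v) \<bullet>c z = a * (v \<bullet>c z)" "z \<bullet>c (a \<cdot>\<^sub>v v) = cnj a * (z \<bullet>c v)"
  using assms by (simp_all add: scalar_prod_def sum_distrib_left algebra_simps)

text \<open>
  The smallest eigenvalue of $X$ is $1/\|X^{-1}\|$. Without eigenvalues: the form of $X$ is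
  nonnegative at $z = v - \kappa^{-1} X^{-1} v$, and its value there is
  $\langle Xv, v\rangle - 2\|v\|^2/\kappa + \langle v, X^{-1}v\rangle/\kappa^2$, where the last term
  is at most $\|v\|^2/\kappa$.
\<close>

lemma pos_def_form_lower_bound:
  assumes X: "pos_def n X" and v: "v \<in> carrier_vec n" and "0 < \<kappa>" and \<kappa>: "spec_norm (inv_mat X) \<le> \<kappa>"
  shows "(vec_norm2 v)\<^sup>2 / \<kappa> \<le> Re ((X *\<^sub>v v) \<bullet>c v)"
proof -
  note P = pos_def_inv_props[OF X X] and Xc = pos_def_carrier[OF X]
  define w where "w = inv_mat X *\<^sub>v v"
  define a where "a = complex_of_real (- 1 / \<kappa>)"
  define z where "z = v + a \<cdot>\<^sub>v w"
  have w: "w \<in> carrier_vec n" using P(1) by (auto simp: w_def intro: carrier_vecI)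
  have z: "z \<in> carrier_vec n" using v w by (simp add: z_def)
  have Xw: "X *\<^sub>v w = v" using P Xc v by (simp add: w_def flip: mult_mat_vec_assoc_dim)
  have Xv: "X *\<^sub>v v \<in> carrier_vec n" using Xc by (intro carrier_vecI) simp
  have Xz: "X *\<^sub>v z = X *\<^sub>v v + a \<cdot>\<^sub>v v"
    using v w Xc Xw by (simp add: z_def mult_add_distrib_mat_vec[of _ n n] mult_mat_vec[of _ n n])
  have "(X *\<^sub>v v) \<bullet>c w = v \<bullet>c v"
    using cscalar_adjoint[OF Xc v w] pos_def_adjoint[OF X] Xw by simp
  moreover have "(X *\<^sub>v z) \<bullet>c z = (X *\<^sub>v v) \<bullet>c v + a * (v \<bullet>c v) + a * ((X *\<^sub>v v) \<bullet>c w) + a * a * (v \<bullet>c w)"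
  proof -
    have "cnj a = a" by (simp add: a_def)
    then show ?thesis unfolding Xz using v w Xc
      by (simp add: z_def cscalar_add cscalar_smult algebra_simps)
  qed
  moreover have "0 \<le> Re ((X *\<^sub>v z) \<bullet>c z)"
  proof (cases "z = 0\<^sub>v n")
    case True
    then show ?thesis by (simp add: scalar_prod_def)
  next
    case False
    then show ?thesis using X z unfolding pos_def_def by (blast intro: less_imp_le)
  qed
  ultimately have "0 \<le> Re ((X *\<^sub>v v) \<bullet>c v) - 2 / \<kappa> * (vec_norm2 v)\<^sup>2 + 1 / \<kappa>\<^sup>2 * Re (v \<bullet>c w)"
    by (simp add: a_def cscalar_self power2_eq_square)
  moreover have "Re (v \<bullet>c w) \<le> \<kappa> * (vec_norm2 v)\<^sup>2"
  proof -
    have "Re (v \<bullet>c w) \<le> vec_norm2 v * vec_norm2 w"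
      using order_trans[OF complex_Re_le_cmod cauchy_schwarz_vec] v w by auto
    also have "\<dots> \<le> vec_norm2 v * (\<kappa> * vec_norm2 v)"
      using spec_norm_bound[of v "inv_mat X"] v P(1) mult_right_mono[OF \<kappa> vec_norm2_nonneg[of v]]
      by (intro mult_left_mono) (auto simp: w_def)
    finally show ?thesis by (simp add: power2_eq_square algebra_simps)
  qed
  then have "1 / \<kappa>\<^sup>2 * Re (v \<bullet>c w) \<le> 1 / \<kappa>\<^sup>2 * (\<kappa> * (vec_norm2 v)\<^sup>2)"
    by (intro mult_left_mono) auto
  moreover have "1 / \<kappa>\<^sup>2 * (\<kappa> * (vec_norm2 v)\<^sup>2) = (vec_norm2 v)\<^sup>2 / \<kappa>"
    using \<open>0 < \<kappa>\<close> by (simp add: power2_eq_square)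
  ultimately show ?thesis by (simp add: field_simps)
qed

lemma pos_def_perturbation:
  assumes X: "pos_def n X" and E: "hermitian_mat n E"
    and small: "\<kappa> * spec_norm E < 1" and "0 < \<kappa>" and \<kappa>: "spec_norm (inv_mat X) \<le> \<kappa>"
  shows "pos_def n (X + E)"
  unfolding pos_def_def
proof (intro conjI ballI impI)
  have Xc: "X \<in> carrier_mat n n" and Ec: "E \<in> carrier_mat n n"
    using pos_def_carrier[OF X] E by (auto simp: hermitian_mat_def)
  show "hermitian_mat n (X + E)"
    using E Xc pos_def_adjoint[OF X] Ec by (auto simp: hermitian_mat_def adjoint_add)
  fix v :: "complex vec" assume v: "v \<in> carrier_vec n" "v \<noteq> 0\<^sub>v n"
  have Ev: "(X + E) *\<^sub>v v = X *\<^sub>v v + E *\<^sub>v v" by (rule add_mult_distrib_mat_vec[OF Xc Ec v(1)])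
  have nv: "0 < vec_norm2 v" using vec_norm2_eq_0[OF v(1)] v(2) by (simp add: less_le)
  have "- Re ((E *\<^sub>v v) \<bullet>c v) \<le> cmod ((E *\<^sub>v v) \<bullet>c v)"
    by (metis abs_Re_le_cmod abs_le_D2)
  also have "\<dots> \<le> vec_norm2 (E *\<^sub>v v) * vec_norm2 v" using v Ec by (intro cauchy_schwarz_vec) auto
  also have "\<dots> \<le> spec_norm E * vec_norm2 v * vec_norm2 v"
    using v Ec by (intro mult_right_mono spec_norm_bound) auto
  also have "\<dots> < 1 / \<kappa> * (vec_norm2 v * vec_norm2 v)"
    using small nv \<open>0 < \<kappa>\<close> unfolding mult.assoc
    by (intro mult_strict_right_mono) (auto simp: field_simps)
  also have "\<dots> \<le> Re ((X *\<^sub>v v) \<bullet>c v)"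
    using pos_def_form_lower_bound[OF X v(1) \<open>0 < \<kappa>\<close> \<kappa>] by (simp add: power2_eq_square)
  finally show "0 < Re (((X + E) *\<^sub>v v) \<bullet>c v)"
    unfolding Ev using v Xc Ec by (simp add: cscalar_add)
qed

text \<open>
  The matrix $(X+E)^{-1}X$ is the inverse of $I + X^{-1}E$. If $w$ is its value at $v$, then
  $v = w + X^{-1}E w$, so that $\|v\| \ge (1-\eta)\|w\|$.
\<close>

lemma inverse_perturbation_factor:
  assumes X: "pos_def n X" and Y: "pos_def n (X + E)" and E: "E \<in> carrier_mat n n"
    and small: "spec_norm (inv_mat X) * spec_norm E \<le> \<eta>" "\<eta> < 1"
  shows "spec_norm (inv_mat (X + E) * X) \<le> 1 / (1 - \<eta>)"
proof (rule spec_norm_le)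
  note P = pos_def_inv_props[OF X X] and R = pos_def_inv_props[OF Y Y] and Xc = pos_def_carrier[OF X]
  let ?G = "inv_mat (X + E) * X"
  fix v :: "complex vec" assume "v \<in> carrier_vec (dim_col ?G)"
  then have v: "v \<in> carrier_vec n" using Xc by simp
  define w where "w = ?G *\<^sub>v v"
  have w: "w \<in> carrier_vec n" using R(1) by (auto simp: w_def intro: carrier_vecI)
  let ?u = "(inv_mat X * E) *\<^sub>v w"
  have u: "?u \<in> carrier_vec n" using P(1) by (intro carrier_vecI) simp
  have "(inv_mat X * (X + E)) *\<^sub>v w = (inv_mat X * ((X + E) * inv_mat (X + E)) * X) *\<^sub>v v"
    using P(1) R(1) Xc E v by (simp add: w_def mult_mat_vec_assoc_dim mult_assoc_dim)
  also have "\<dots> = v" using P R(2) v by simp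
  also have "inv_mat X * (X + E) = 1\<^sub>m n + inv_mat X * E"
    using P Xc E by (simp add: mult_distrib_dim)
  also have "(1\<^sub>m n + inv_mat X * E) *\<^sub>v w = w + ?u"
    using P(1) E w by (subst add_mult_distrib_mat_vec[of _ n n]) auto
  finally have "v = w + ?u" by simp
  then have "w = v + (-1) \<cdot>\<^sub>v ?u" using u w P(1) by (intro eq_vecI) auto
  then have "vec_norm2 w \<le> vec_norm2 v + vec_norm2 ?u"
    using vec_norm2_add[of v "(-1) \<cdot>\<^sub>v ?u"] v u P(1) by simp
  also have "vec_norm2 ?u \<le> spec_norm (inv_mat X * E) * vec_norm2 w"
    using E w by (intro spec_norm_bound) auto
  also have "\<dots> \<le> \<eta> * vec_norm2 w"
    using spec_norm_mult[of "inv_mat X" E] P(1) E small(1) by (intro mult_right_mono) auto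
  finally show "vec_norm2 (?G *\<^sub>v v) \<le> 1 / (1 - \<eta>) * vec_norm2 v"
    using small(2) unfolding w_def[symmetric] by (simp add: field_simps)
qed (use small in simp)

lemma hermitian_solution_pos_def_iff:
  assumes Y: "pos_def n Y"
  shows "hermitian_solution m n A Q Y \<longleftrightarrow> Y + mat_adjoint A * hat m (inv_mat Y) * A = Q"
  using Y pos_def_invertible[OF Y] inv_mat_hat[OF pos_def_carrier[OF Y] pos_def_invertible[OF Y]]
  by (simp add: hermitian_solution_def pos_def_def)

text \<open>
  Both orders of the factors are needed: substituting one identity in the other expands
  $X^{-1} - Y^{-1}$ to second order.
\<close>

lemma inv_mat_minus:
  assumes X: "pos_def n X" and Y: "pos_def n Y"
  shows "inv_mat X - inv_mat Y = inv_mat X * (Y - X) * inv_mat Y"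
    and "inv_mat X - inv_mat Y = inv_mat Y * (Y - X) * inv_mat X"
proof -
  note P = pos_def_inv_props[OF X X] and R = pos_def_inv_props[OF Y Y]
  have "inv_mat X * (Y - X) * inv_mat Y = inv_mat X * (Y * inv_mat Y) - (inv_mat X * X) * inv_mat Y"
    using P(1) R(1) pos_def_carrier[OF X] pos_def_carrier[OF Y]
    by (simp add: mult_distrib_dim mult_assoc_dim)
  then show "inv_mat X - inv_mat Y = inv_mat X * (Y - X) * inv_mat Y" using P R by simp
  have "inv_mat Y * (Y - X) * inv_mat X = (inv_mat Y * Y) * inv_mat X - inv_mat Y * (X * inv_mat X)"
    using P(1) R(1) pos_def_carrier[OF X] pos_def_carrier[OF Y]
    by (simp add: mult_distrib_dim mult_assoc_dim)
  then show "inv_mat X - inv_mat Y = inv_mat Y * (Y - X) * inv_mat X" using P R by simp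
qed

section \<open>A criterion for maximality\<close>

text \<open>
  Let $Y$ be another positive definite solution and $E = Y - X$. Subtracting the equations gives
  $E = A^*\,\widehat{X^{-1} - Y^{-1}}\,A$, and to second order
  $X^{-1} - Y^{-1} = X^{-1}(E - E Y^{-1} E) X^{-1} \le X^{-1} E X^{-1}$. With
  $B = \widehat{X^{-1}}A$ this reads $E \le B^* \widehat{E} B$. So a bound $C\|v\|^2$ of the form of
  $E$ improves to $\|B\|^2 C\|v\|^2$; starting from $C = \|E\|$ and iterating, $E \le 0$.
\<close>

lemma maximal_if_spec_norm_less_1:
  assumes X: "pos_def n X" and sol: "hermitian_solution m n A Q X"
    and A: "A \<in> carrier_mat (m * n) n"
    and \<rho>: "spec_norm (hat m (inv_mat X) * A) < 1"
  shows "maximal_pd_solution m n A Q X"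
  unfolding maximal_pd_solution_def
proof (intro conjI allI impI sol X)
  fix Y assume "hermitian_solution m n A Q Y \<and> pos_def n Y"
  then have Y: "pos_def n Y" and "hermitian_solution m n A Q Y" by auto
  then have solY: "Y + mat_adjoint A * hat m (inv_mat Y) * A = Q"
    using hermitian_solution_pos_def_iff by blast
  have solX: "X + mat_adjoint A * hat m (inv_mat X) * A = Q"
    using sol hermitian_solution_pos_def_iff[OF X] by blast
  note P = pos_def_inv_props[OF X X] and R = pos_def_inv_props[OF Y Y]
    and Xc = pos_def_carrier[OF X] and Yc = pos_def_carrier[OF Y]
  define E where "E = Y - X"
  have E: "E \<in> carrier_mat n n" unfolding E_def by (rule minus_carrier_mat[OF Xc])
  have adjE: "mat_adjoint E = E"
    using Xc Yc pos_def_adjoint[OF X] pos_def_adjoint[OF Y] by (simp add: E_def adjoint_minus)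
  define B where "B = hat m (inv_mat X) * A"
  have B: "B \<in> carrier_mat (m * n) n" unfolding B_def by (rule mult_carrier_mat[OF hat_carrier[OF P(1)] A])
  have adjB: "mat_adjoint B = mat_adjoint A * hat m (inv_mat X)"
    using A P(1) by (simp add: B_def adjoint_mult adjoint_inv_mat[OF X] flip: hat_adjoint)
  define H where "H = hat m (inv_mat Y)"
  have H: "H \<in> carrier_mat (m * n) (m * n)" using R(1) by (simp add: H_def)
  define F where "F = hat m E"
  have F: "F \<in> carrier_mat (m * n) (m * n)" using E by (simp add: F_def)
  have adjF: "mat_adjoint F = F" by (simp add: F_def adjE flip: hat_adjoint)
  \<comment> \<open>One of the two first-order identities for the difference is inserted into the other.\<close>
  have Pdiff: "inv_mat X - inv_mat Y = inv_mat X * (E - E * inv_mat Y * E) * inv_mat X"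
  proof -
    have "inv_mat Y = inv_mat X - inv_mat Y * E * inv_mat X"
      unfolding E_def inv_mat_minus(2)[OF X Y, symmetric] by (rule eq_matI) (use P(1) R(1) in auto)
    then have "inv_mat X * E * inv_mat Y = inv_mat X * E * (inv_mat X - inv_mat Y * E * inv_mat X)"
      by simp
    also have "\<dots> = inv_mat X * (E - E * inv_mat Y * E) * inv_mat X"
      using P(1) R(1) E by (simp add: mult_distrib_dim mult_assoc_dim)
    finally show ?thesis using inv_mat_minus(1)[OF X Y] by (simp add: E_def)
  qed
  have "E = mat_adjoint A * hat m (inv_mat X) * A - mat_adjoint A * hat m (inv_mat Y) * A"
  proof (rule eq_matI)
    fix i j assume "i < dim_row (mat_adjoint A * hat m (inv_mat X) * A - mat_adjoint A * hat m (inv_mat Y) * A)"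
      "j < dim_col (mat_adjoint A * hat m (inv_mat X) * A - mat_adjoint A * hat m (inv_mat Y) * A)"
    then have ij: "i < n" "j < n" using A by auto
    have "(Y + mat_adjoint A * hat m (inv_mat Y) * A) $$ (i, j) = (X + mat_adjoint A * hat m (inv_mat X) * A) $$ (i, j)"
      by (simp only: solX solY)
    then show "E $$ (i, j) = (mat_adjoint A * hat m (inv_mat X) * A - mat_adjoint A * hat m (inv_mat Y) * A) $$ (i, j)"
      using ij A Xc Yc by (simp add: E_def algebra_simps del: index_mult_mat(1))
  qed (use E A in auto)
  also have "\<dots> = mat_adjoint A * hat m (inv_mat X - inv_mat Y) * A"
    using A P(1) R(1) by (simp add: hat_minus mult_distrib_dim)
  also have "\<dots> = mat_adjoint B * (F - F * H * F) * B"
    unfolding Pdiff adjB using A P(1) R(1) E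
    by (simp add: B_def F_def H_def hat_mult hat_minus mult_assoc_dim)
  finally have E_eq: "E = mat_adjoint B * (F - F * H * F) * B" .
  \<comment> \<open>The second-order term has a sign because the inverse of \<^term>\<open>Y\<close> is positive.\<close>
  have form_step: "Re ((E *\<^sub>v v) \<bullet>c v) \<le> Re ((F *\<^sub>v (B *\<^sub>v v)) \<bullet>c (B *\<^sub>v v))" if v: "v \<in> carrier_vec n" for v
  proof -
    let ?b = "B *\<^sub>v v"
    have b: "?b \<in> carrier_vec (m * n)" using B by (intro carrier_vecI) simp
    have Fb: "F *\<^sub>v ?b \<in> carrier_vec (m * n)" using F by (intro carrier_vecI) simp
    have HFb: "H *\<^sub>v (F *\<^sub>v ?b) \<in> carrier_vec (m * n)" using H by (intro carrier_vecI) simp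
    have FHFb: "F *\<^sub>v (H *\<^sub>v (F *\<^sub>v ?b)) \<in> carrier_vec (m * n)" using F by (intro carrier_vecI) simp
    have "E *\<^sub>v v = mat_adjoint B *\<^sub>v ((F - F * H * F) *\<^sub>v ?b)"
      unfolding E_eq using B F H v by (simp add: mult_mat_vec_assoc_dim)
    also have "(F - F * H * F) *\<^sub>v ?b = F *\<^sub>v ?b - (F * H * F) *\<^sub>v ?b"
      using b F H by (intro minus_mult_distrib_mat_vec) auto
    also have "(F * H * F) *\<^sub>v ?b = F *\<^sub>v (H *\<^sub>v (F *\<^sub>v ?b))"
      using B F H by (simp add: mult_mat_vec_assoc_dim)
    also have "F *\<^sub>v ?b - F *\<^sub>v (H *\<^sub>v (F *\<^sub>v ?b)) = F *\<^sub>v ?b + (-1) \<cdot>\<^sub>v (F *\<^sub>v (H *\<^sub>v (F *\<^sub>v ?b)))"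
      using Fb FHFb by (intro eq_vecI) auto
    finally have "(E *\<^sub>v v) \<bullet>c v = (F *\<^sub>v ?b + (-1) \<cdot>\<^sub>v (F *\<^sub>v (H *\<^sub>v (F *\<^sub>v ?b)))) \<bullet>c ?b"
      using cscalar_adjoint[OF adjoint_carrier[OF B], of "F *\<^sub>v ?b + (-1) \<cdot>\<^sub>v (F *\<^sub>v (H *\<^sub>v (F *\<^sub>v ?b)))" v] Fb FHFb v
      by simp
    also have "\<dots> = (F *\<^sub>v ?b) \<bullet>c ?b - (H *\<^sub>v (F *\<^sub>v ?b)) \<bullet>c (F *\<^sub>v ?b)"
      using B F cscalar_adjoint[OF F HFb b] adjF by (simp add: cscalar_add cscalar_smult)
    finally have "Re ((E *\<^sub>v v) \<bullet>c v) = Re ((F *\<^sub>v ?b) \<bullet>c ?b) - Re ((H *\<^sub>v (F *\<^sub>v ?b)) \<bullet>c (F *\<^sub>v ?b))"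
      by simp
    moreover have "0 \<le> Re ((H *\<^sub>v (F *\<^sub>v ?b)) \<bullet>c (F *\<^sub>v ?b))"
      using hat_quadratic_form_le[OF R(1), of "-1" 0 "F *\<^sub>v ?b" m] inv_mat_form_nonneg[OF Y] Fb
      by (simp add: H_def)
    ultimately show ?thesis by simp
  qed
  define \<rho> where "\<rho> = spec_norm B"
  have \<rho>: "0 \<le> \<rho>" "\<rho> < 1" using assms(4) by (simp_all add: \<rho>_def B_def)
  have iter: "Re ((E *\<^sub>v v) \<bullet>c v) \<le> (\<rho>\<^sup>2) ^ k * spec_norm E * (vec_norm2 v)\<^sup>2" if "v \<in> carrier_vec n" for v k
    using that
  proof (induction k arbitrary: v)
    case 0
    have "Re ((E *\<^sub>v v) \<bullet>c v) \<le> vec_norm2 (E *\<^sub>v v) * vec_norm2 v"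
      using 0 E by (intro order_trans[OF complex_Re_le_cmod cauchy_schwarz_vec]) auto
    also have "\<dots> \<le> spec_norm E * vec_norm2 v * vec_norm2 v"
      using 0 E by (intro mult_right_mono spec_norm_bound) auto
    finally show ?case by (simp add: power2_eq_square algebra_simps)
  next
    case (Suc k)
    have b: "B *\<^sub>v v \<in> carrier_vec (m * n)" using B by (intro carrier_vecI) simp
    have "Re ((E *\<^sub>v v) \<bullet>c v) \<le> (\<rho>\<^sup>2) ^ k * spec_norm E * (vec_norm2 (B *\<^sub>v v))\<^sup>2"
      using form_step[OF Suc.prems] hat_quadratic_form_le[OF E, of 1 "(\<rho>\<^sup>2) ^ k * spec_norm E" "B *\<^sub>v v" m] Suc.IH b
      by (simp add: F_def)
    also have "\<dots> \<le> (\<rho>\<^sup>2) ^ k * spec_norm E * (\<rho> * vec_norm2 v)\<^sup>2"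
      using Suc.prems B unfolding \<rho>_def by (intro mult_left_mono power_mono spec_norm_bound) auto
    finally show ?case by (simp add: power_mult_distrib algebra_simps)
  qed
  have nonpos: "Re ((E *\<^sub>v v) \<bullet>c v) \<le> 0" if "v \<in> carrier_vec n" for v
  proof (rule LIMSEQ_le_const)
    have "\<rho>\<^sup>2 < 1" using \<rho> by (simp add: power2_less_1_iff)
    then have "(\<lambda>k. (\<rho>\<^sup>2) ^ k) \<longlonglongrightarrow> 0" using \<rho> by (intro LIMSEQ_power_zero) simp
    then show "(\<lambda>k. (\<rho>\<^sup>2) ^ k * spec_norm E * (vec_norm2 v)\<^sup>2) \<longlonglongrightarrow> 0"
      by (intro tendsto_mult_left_zero)
    show "\<exists>N. \<forall>k\<ge>N. Re ((E *\<^sub>v v) \<bullet>c v) \<le> (\<rho>\<^sup>2) ^ k * spec_norm E * (vec_norm2 v)\<^sup>2"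
      using iter[OF that] by blast
  qed
  have "(X - Y) *\<^sub>v v = (-1) \<cdot>\<^sub>v (E *\<^sub>v v)" if "v \<in> carrier_vec n" for v
    using that Xc Yc by (intro eq_vecI) (auto simp: E_def scalar_prod_def algebra_simps sum_subtractf)
  then have "0 \<le> Re (((X - Y) *\<^sub>v v) \<bullet>c v)" if "v \<in> carrier_vec n" for v
    using nonpos[OF that] that E by (simp add: cscalar_smult)
  moreover have "hermitian_mat n (X - Y)"
    using Xc Yc pos_def_adjoint[OF X] pos_def_adjoint[OF Y] minus_carrier_mat[OF Yc]
    by (simp add: hermitian_mat_def adjoint_minus)
  ultimately show "loewner_le n Y X" by (simp add: loewner_le_def pos_semidef_def)
qed

section \<open>The fixed point equation for the correction\<close>

text \<open>
  The correction $E = \tilde X - X$ is a fixed point of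
  $\Phi(E) = \tilde Q - \tilde A^* \widehat{(X+E)^{-1}} \tilde A - X$. Inserting
  $X^{-1} - (X+E)^{-1} = X^{-1} E (X+E)^{-1}$ displays every term of $\Phi(E)$ as small in
  $E$, $\Delta A$ or $\Delta Q$. The terms that are linear in $\Delta A$ are kept as a matrix and
  its adjoint, so that only one of them has to be estimated.
\<close>

lemma fixpoint_map_expansion:
  assumes X: "pos_def n X" and Y: "pos_def n (X + E)" and E: "E \<in> carrier_mat n n"
    and A: "A \<in> carrier_mat (m * n) n" and dA: "dA \<in> carrier_mat (m * n) n" and dQ: "dQ \<in> carrier_mat n n"
  defines "R \<equiv> inv_mat (X + E)" and "B \<equiv> hat m (inv_mat X) * A"
  defines "C \<equiv> hat m (R * X) * B"
  shows "X + mat_adjoint A * hat m (inv_mat X) * A + dQ - mat_adjoint (A + dA) * hat m R * (A + dA) - X =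
    dQ + mat_adjoint B * hat m E * C - mat_adjoint C * dA - mat_adjoint (mat_adjoint C * dA)
      - mat_adjoint dA * hat m R * dA"
proof -
  note P = pos_def_inv_props[OF X X] and R = pos_def_inv_props[OF Y Y, folded R_def] and Xc = pos_def_carrier[OF X]
  have Bc: "B \<in> carrier_mat (m * n) n" unfolding B_def by (rule mult_carrier_mat[OF hat_carrier[OF P(1)] A])
  have "R * X * inv_mat X = R * (X * inv_mat X)" using R(1) Xc P(1) by (simp add: mult_assoc_dim)
  then have GP: "R * X * inv_mat X = R" using P R by simp
  have "C = hat m (R * X * inv_mat X) * A"
    using R(1) Xc P(1) A by (simp add: C_def B_def hat_mult mult_assoc_dim)
  then have C: "C = hat m R * A" by (simp add: GP)
  have adjC: "mat_adjoint C = mat_adjoint A * hat m R"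
    using A R(1) by (simp add: C adjoint_mult adjoint_inv_mat[OF Y, folded R_def] flip: hat_adjoint)
  have adjB: "mat_adjoint B = mat_adjoint A * hat m (inv_mat X)"
    using A P(1) by (simp add: B_def adjoint_mult adjoint_inv_mat[OF X] flip: hat_adjoint)
  have adjCdA: "mat_adjoint (mat_adjoint C * dA) = mat_adjoint dA * hat m R * A"
    using A dA R(1) by (subst adjoint_mult) (auto simp: C mult_assoc_dim)
  have "X + E - X = E" using Xc E by (intro eq_matI) auto
  then have diff: "inv_mat X - R = inv_mat X * E * R"
    using inv_mat_minus(1)[OF X Y] by (simp add: R_def)
  have T: "mat_adjoint A * hat m (inv_mat X) * A - mat_adjoint A * hat m R * A = mat_adjoint B * hat m E * C"
  proof -
    have "mat_adjoint A * hat m (inv_mat X) * A - mat_adjoint A * hat m R * A = mat_adjoint A * hat m (inv_mat X - R) * A"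
      using A P(1) R(1) by (simp add: hat_minus mult_distrib_dim)
    also have "\<dots> = mat_adjoint B * hat m E * C"
      unfolding diff adjB using A P(1) R(1) E by (simp add: C hat_mult mult_assoc_dim)
    finally show ?thesis .
  qed
  have "mat_adjoint (A + dA) * hat m R * (A + dA) =
      mat_adjoint A * hat m R * A + mat_adjoint dA * hat m R * A + (mat_adjoint A * hat m R * dA + mat_adjoint dA * hat m R * dA)"
    using A dA R(1) by (simp add: adjoint_add mult_distrib_dim mult_assoc_dim)
  then show ?thesis
    unfolding T[symmetric] adjC adjCdA[unfolded adjC]
    by (intro eq_matI) (use Xc dQ A dA R(1) P(1) in \<open>auto simp del: index_mult_mat(1)\<close>)
qed

text \<open>
  The two ways to estimate $B^* \widehat{E}\, \widehat{G} B$, where $G = (X+E)^{-1}X$, produce the minimum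
  $K_U$: the norm is spent either on $\widehat{E}$, at the cost of the factor $\theta_U(m)$, or on the
  last factor $B$. The right-hand side is the function of $S$ that has $S_{err}$ as a fixed point.
\<close>

lemma fixpoint_map_norm_le:
  assumes N: "unitarily_invariant_norm N" and th: "is_theta N n m \<theta>"
    and X: "pos_def n X" and Y: "pos_def n (X + E)" and E: "E \<in> carrier_mat n n"
    and A: "A \<in> carrier_mat (m * n) n" and dA: "dA \<in> carrier_mat (m * n) n" and dQ: "dQ \<in> carrier_mat n n"
    and ES: "N E \<le> S" and \<kappa>S: "spec_norm (inv_mat X) * S < 1" and \<theta>: "0 \<le> \<theta>"
  defines "R \<equiv> inv_mat (X + E)" and "B \<equiv> hat m (inv_mat X) * A" and "\<kappa> \<equiv> spec_norm (inv_mat X)"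
  shows "N (X + mat_adjoint A * hat m (inv_mat X) * A + dQ - mat_adjoint (A + dA) * hat m R * (A + dA) - X) \<le>
    N dQ + (min (\<theta> * spec_norm B) (N B) * spec_norm B * S + 2 * spec_norm B * N dA + \<kappa> * (N dA)\<^sup>2) / (1 - \<kappa> * S)"
proof -
  note P = pos_def_inv_props[OF X X] and R = pos_def_inv_props[OF Y Y, folded R_def] and Xc = pos_def_carrier[OF X]
  define \<beta> where "\<beta> = spec_norm B"
  define g where "g = 1 / (1 - \<kappa> * S)"
  define G where "G = R * X"
  define C where "C = hat m G * B"
  have \<beta>0: "0 \<le> \<beta>" by (simp add: \<beta>_def)
  have \<kappa>0: "0 \<le> \<kappa>" by (simp add: \<kappa>_def)
  have g0: "0 < g" using \<kappa>S by (simp add: g_def \<kappa>_def)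
  have S0: "0 \<le> S" using uinv_normD(1)[OF N E] ES by simp
  have \<delta>0: "0 \<le> N dA" by (rule uinv_normD(1)[OF N dA])
  have Bc: "B \<in> carrier_mat (m * n) n" unfolding B_def by (rule mult_carrier_mat[OF hat_carrier[OF P(1)] A])
  have Gc: "G \<in> carrier_mat n n" unfolding G_def by (rule mult_carrier_mat[OF R(1) Xc])
  have Cc: "C \<in> carrier_mat (m * n) n" unfolding C_def by (rule mult_carrier_mat[OF hat_carrier[OF Gc] Bc])
  have sE: "spec_norm E \<le> S" using uinv_normD(5)[OF N E] ES by simp
  have G_le: "spec_norm G \<le> g"
    unfolding G_def R_def g_def
    by (rule inverse_perturbation_factor[OF X Y E]) (use sE \<kappa>0 \<kappa>S in \<open>auto simp: \<kappa>_def intro: mult_left_mono\<close>)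
  have hG: "spec_norm (hat m G) \<le> g" using spec_norm_hat_le[OF Gc] G_le order_trans by blast
  have C_le: "spec_norm C \<le> g * \<beta>"
    using spec_norm_mult[of "hat m G" B] mult_right_mono[OF hG \<beta>0] Gc Bc by (simp add: C_def \<beta>_def)
  have adjB_le: "spec_norm (mat_adjoint B) \<le> \<beta>" by (simp add: \<beta>_def spec_norm_adjoint_le)
  have R_le: "spec_norm (hat m R) \<le> g * \<kappa>"
  proof -
    have "R = G * inv_mat X" using R(1) Xc P by (simp add: G_def mult_assoc_dim)
    then have "spec_norm R \<le> spec_norm G * \<kappa>" using spec_norm_mult[of G "inv_mat X"] Gc P(1) by (simp add: \<kappa>_def)
    also have "\<dots> \<le> g * \<kappa>" using G_le \<kappa>0 by (rule mult_right_mono)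
    finally show ?thesis using spec_norm_hat_le[OF R(1), of m] by simp
  qed
  define T1 where "T1 = mat_adjoint B * hat m E * C"
  define T2 where "T2 = mat_adjoint C * dA"
  define T4 where "T4 = mat_adjoint dA * hat m R * dA"
  have T1c: "T1 \<in> carrier_mat n n" and T2c: "T2 \<in> carrier_mat n n" and T4c: "T4 \<in> carrier_mat n n"
    using Bc Cc dA by (auto simp: T1_def T2_def T4_def intro!: carrier_matI)
  have "N T1 \<le> \<theta> * \<beta> * (g * \<beta> * S)"
  proof -
    have "N T1 \<le> spec_norm (mat_adjoint B) * N (hat m E) * spec_norm C"
      unfolding T1_def by (rule uinv_normD(6)[OF N adjoint_carrier[OF Bc] hat_carrier[OF E] Cc])
    also have "\<dots> \<le> \<beta> * (\<theta> * S) * (g * \<beta>)"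
    proof (intro mult_mono adjB_le C_le)
      show "N (hat m E) \<le> \<theta> * S"
        using norm_hat_le_theta[OF N th E] mult_left_mono[OF ES \<theta>] by simp
    qed (use \<beta>0 \<theta> S0 g0 uinv_normD(1)[OF N hat_carrier[OF E]] in auto)
    finally show ?thesis by (simp add: algebra_simps)
  qed
  moreover have "N T1 \<le> N B * (g * \<beta> * S)"
  proof -
    have "N T1 = N (mat_adjoint B * (hat m E * hat m G) * B)"
      using Bc E Gc by (simp add: T1_def C_def mult_assoc_dim)
    also have "\<dots> \<le> spec_norm (mat_adjoint B * (hat m E * hat m G)) * N B"
      by (rule uinv_norm_mult(1)[OF N _ Bc]) (use Bc E Gc in \<open>auto intro!: carrier_matI\<close>)
    also have "\<dots> \<le> (\<beta> * (S * g)) * N B"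
    proof (rule mult_right_mono)
      have "spec_norm (mat_adjoint B * (hat m E * hat m G)) \<le> spec_norm (mat_adjoint B) * (spec_norm (hat m E) * spec_norm (hat m G))"
        using Bc E Gc
        by (intro order_trans[OF spec_norm_mult mult_left_mono[OF spec_norm_mult]]) auto
      also have "\<dots> \<le> \<beta> * (S * g)"
        using adjB_le hG order_trans[OF spec_norm_hat_le[OF E] sE] \<beta>0 S0 by (intro mult_mono mult_nonneg_nonneg) auto
      finally show "spec_norm (mat_adjoint B * (hat m E * hat m G)) \<le> \<beta> * (S * g)" .
    qed (rule uinv_normD(1)[OF N Bc])
    finally show ?thesis by (simp add: algebra_simps)
  qed
  ultimately have T1: "N T1 \<le> min (\<theta> * \<beta>) (N B) * (g * \<beta> * S)"
    by (cases "\<theta> * \<beta> \<le> N B") (auto simp: min_def)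
  have T2: "N T2 \<le> g * \<beta> * N dA"
  proof -
    have "N T2 \<le> spec_norm (mat_adjoint C) * N dA"
      unfolding T2_def by (rule uinv_norm_mult(1)[OF N adjoint_carrier[OF Cc] dA])
    also have "\<dots> \<le> g * \<beta> * N dA"
      using order_trans[OF spec_norm_adjoint_le C_le] \<delta>0 by (rule mult_right_mono)
    finally show ?thesis .
  qed
  have T3: "N (mat_adjoint T2) \<le> g * \<beta> * N dA"
    using uinv_norm_adjoint_le[OF N T2c] T2 by simp
  have T4: "N T4 \<le> g * \<kappa> * (N dA)\<^sup>2"
  proof -
    have "N T4 \<le> spec_norm (mat_adjoint dA * hat m R) * N dA"
      unfolding T4_def by (rule uinv_norm_mult(1)[OF N mult_carrier_mat[OF adjoint_carrier[OF dA] hat_carrier[OF R(1)]] dA])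
    also have "\<dots> \<le> (N dA * (g * \<kappa>)) * N dA"
    proof (rule mult_right_mono[OF _ \<delta>0])
      have "spec_norm (mat_adjoint dA * hat m R) \<le> spec_norm (mat_adjoint dA) * spec_norm (hat m R)"
        using dA R(1) by (intro spec_norm_mult) auto
      also have "\<dots> \<le> N dA * (g * \<kappa>)"
        using order_trans[OF spec_norm_adjoint_le uinv_normD(5)[OF N dA]] R_le \<delta>0 by (intro mult_mono) auto
      finally show "spec_norm (mat_adjoint dA * hat m R) \<le> N dA * (g * \<kappa>)" .
    qed
    finally show ?thesis by (simp add: power2_eq_square algebra_simps)
  qed
  have "N (dQ + T1 - T2 - mat_adjoint T2 - T4) \<le> N dQ + N T1 + N T2 + N (mat_adjoint T2) + N T4"
    using uinv_normD(4)[OF N dQ T1c] uinv_norm_minus[OF N add_carrier_mat[OF T1c] T2c, of dQ]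
      uinv_norm_minus[OF N minus_carrier_mat[OF T2c] adjoint_carrier[OF T2c], of "dQ + T1"]
      uinv_norm_minus[OF N minus_carrier_mat[OF adjoint_carrier[OF T2c]] T4c, of "dQ + T1 - T2"] by linarith
  also have "\<dots> \<le> N dQ + (min (\<theta> * \<beta>) (N B) * \<beta> * S + 2 * \<beta> * N dA + \<kappa> * (N dA)\<^sup>2) * g"
    using T1 T2 T3 T4 by (simp add: algebra_simps)
  finally show ?thesis
    unfolding fixpoint_map_expansion[OF X Y E A dA dQ, folded R_def B_def]
    by (simp add: T1_def T2_def T4_def C_def G_def g_def \<beta>_def)
qed

text \<open>
  One estimate with two uses: if the right-hand side is less than 1, it makes $\Phi$ a contraction and
  it makes the solution that corresponds to $E$ maximal.
\<close>

lemma perturbed_coefficient_norm_le: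
  assumes X: "pos_def n X" and Y: "pos_def n (X + E)" and E: "E \<in> carrier_mat n n"
    and A: "A \<in> carrier_mat (m * n) n" and dA: "dA \<in> carrier_mat (m * n) n"
    and small: "spec_norm (inv_mat X) * spec_norm E \<le> \<eta>" "\<eta> < 1"
  shows "spec_norm (hat m (inv_mat (X + E)) * (A + dA)) \<le>
    (spec_norm (hat m (inv_mat X) * A) + spec_norm (inv_mat X) * spec_norm dA) / (1 - \<eta>)"
proof -
  note P = pos_def_inv_props[OF X X] and R = pos_def_inv_props[OF Y Y] and Xc = pos_def_carrier[OF X]
  let ?G = "inv_mat (X + E) * X"
  let ?B = "hat m (inv_mat X) * A + hat m (inv_mat X) * dA"
  have "inv_mat (X + E) = ?G * inv_mat X" using R(1) Xc P by (simp add: mult_assoc_dim)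
  then have "hat m (inv_mat (X + E)) = hat m ?G * hat m (inv_mat X)"
    using R(1) Xc P(1) by (metis carrier_matD(1) carrier_matD(2) hat_mult index_mult_mat(3))
  then have "hat m (inv_mat (X + E)) * (A + dA) = hat m ?G * ?B"
    using R(1) Xc P(1) A dA by (simp add: mult_assoc_dim mult_distrib_dim)
  also have "spec_norm \<dots> \<le> spec_norm (hat m ?G) * spec_norm ?B"
    using R(1) Xc P(1) A dA by (intro spec_norm_mult) auto
  also have "\<dots> \<le> 1 / (1 - \<eta>) * (spec_norm (hat m (inv_mat X) * A) + spec_norm (inv_mat X) * spec_norm dA)"
  proof (intro mult_mono)
    show "spec_norm (hat m ?G) \<le> 1 / (1 - \<eta>)"
      using spec_norm_hat_le[OF mult_carrier_mat[OF R(1) Xc]] inverse_perturbation_factor[OF X Y E small]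
      by (rule order_trans)
    have "spec_norm ?B \<le> spec_norm (hat m (inv_mat X) * A) + spec_norm (hat m (inv_mat X) * dA)"
      using P(1) A dA by (intro spec_norm_add) auto
    also have "spec_norm (hat m (inv_mat X) * dA) \<le> spec_norm (hat m (inv_mat X)) * spec_norm dA"
      using P(1) dA by (intro spec_norm_mult) auto
    also have "\<dots> \<le> spec_norm (inv_mat X) * spec_norm dA"
      by (intro mult_right_mono spec_norm_hat_le[OF P(1)]) auto
    finally show "spec_norm ?B \<le> spec_norm (hat m (inv_mat X) * A) + spec_norm (inv_mat X) * spec_norm dA" by simp
  qed (use small in auto)
  finally show ?thesis by simp
qed

lemma pos_def_inv_norm_pos:
  assumes X: "pos_def n X" and "0 < n"
  shows "0 < spec_norm (inv_mat X)"
proof (rule ccontr)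
  note P = pos_def_inv_props[OF X X] and Xc = pos_def_carrier[OF X]
  assume "\<not> 0 < spec_norm (inv_mat X)"
  then have "inv_mat X = 0\<^sub>m n n" using spec_norm_eq_0_imp[OF P(1)] by simp
  then have "(0\<^sub>m n n :: complex mat) = 1\<^sub>m n" using P(2) Xc by simp
  then have "(0\<^sub>m n n :: complex mat) $$ (0, 0) = 1\<^sub>m n $$ (0, 0)" by simp
  then show False using \<open>0 < n\<close> by simp
qed

text \<open>
  The contraction estimate is in the spectral norm, whereas the invariant set is a ball of the
  norm \<^term>\<open>N\<close>. The two fit together because $N(Z) \le \|Z\|\,N(I)$.
\<close>

lemma norm_ball_closed:
  assumes N: "unitarily_invariant_norm N"
    and x: "\<And>k. hermitian_mat n (x k) \<and> N (x k) \<le> S"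
    and X: "X \<in> carrier_mat n n" and conv: "(\<lambda>k. spec_norm (x k - X)) \<longlonglongrightarrow> 0"
  shows "hermitian_mat n X \<and> N X \<le> S"
proof
  have xc: "x k \<in> carrier_mat n n" and xa: "mat_adjoint (x k) = x k" for k
    using x by (auto simp: hermitian_mat_def)
  have entry: "(\<lambda>k. x k $$ (i, j)) \<longlonglongrightarrow> X $$ (i, j)" if "i < n" "j < n" for i j
  proof (rule LIM_zero_cancel, rule tendsto_norm_zero_cancel, rule tendsto_sandwich[OF _ _ tendsto_const conv])
    show "\<forall>\<^sub>F k in sequentially. norm (x k $$ (i, j) - X $$ (i, j)) \<le> spec_norm (x k - X)"
      using entry_le_spec_norm[of i "x _ - X" j] that X xc by (intro always_eventually allI) simp
  qed simp
  have "mat_adjoint X = X"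
  proof (rule eq_matI)
    fix i j assume "i < dim_row X" "j < dim_col X"
    then have ij: "i < n" "j < n" using X by auto
    have "(\<lambda>k. cnj (x k $$ (j, i))) \<longlonglongrightarrow> cnj (X $$ (j, i))"
      using entry[OF ij(2,1)] by (rule tendsto_cnj)
    moreover have "cnj (x k $$ (j, i)) = x k $$ (i, j)" for k
      using adjoint_index[of i "x k" j] xa[of k] xc[of k] ij by auto
    ultimately have "cnj (X $$ (j, i)) = X $$ (i, j)"
      using LIMSEQ_unique[OF entry[OF ij]] by simp
    then show "mat_adjoint X $$ (i, j) = X $$ (i, j)" using ij X by simp
  qed (use X in auto)
  then show "hermitian_mat n X" using X by (simp add: hermitian_mat_def)
  have "N X \<le> S + spec_norm (x k - X) * N (1\<^sub>m n)" for k
  proof -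
    have "X = x k - (x k - X)" using X xc[of k] by (intro eq_matI) auto
    then have "N X \<le> N (x k) + N (x k - X)"
      using uinv_norm_minus[OF N xc minus_carrier_mat[OF X]] by metis
    moreover have "N (x k - X) \<le> spec_norm (x k - X) * N (1\<^sub>m n)"
      using uinv_norm_mult(1)[OF N minus_carrier_mat[OF X, of "x k"] one_carrier_mat]
        right_mult_one_mat[OF minus_carrier_mat[OF X, of "x k"]] by simp
    ultimately show ?thesis using x[of k] by simp
  qed
  moreover have "(\<lambda>k. S + spec_norm (x k - X) * N (1\<^sub>m n)) \<longlonglongrightarrow> S + 0 * N (1\<^sub>m n)"
    by (intro tendsto_intros conv)
  ultimately show "N X \<le> S" by (intro LIMSEQ_le_const[of _ S]) auto
qed

section \<open>The quadratic equation and the theorem\<close>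

text \<open>
  Write $t = \sqrt{K\beta}$, $d = \kappa\delta$, $p = \kappa q$ and
  $e = (1-t)^2 - 2d - p$, which the smallness condition makes positive. Then
  $D = 8d(t-\beta) + e(4(t+d)+e)$, and $\beta \le t$ follows from $\beta \le K$. The smaller
  root $S$ of $\kappa S^2 - bS + c = 0$ satisfies $2\kappa S < b \le 2 - 2\beta - 2d$, which is the third
  claim; the fourth is the quadratic equation, divided by $1-\kappa S$.
\<close>

lemma root_bounds:
  fixes \<beta> \<delta> q \<kappa> K :: real
  assumes nn: "0 \<le> \<beta>" "0 \<le> \<delta>" "0 \<le> q" "0 < \<kappa>" and K: "\<beta> \<le> K" "K * \<beta> < 1"
    and small: "2 * \<delta> + q < (1 - sqrt (K * \<beta>))\<^sup>2 / \<kappa>"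
  defines "b \<equiv> 1 - K * \<beta> + \<kappa> * q"
    and "c \<equiv> q + 2 * \<beta> * \<delta> + \<kappa> * \<delta>\<^sup>2"
  defines "D \<equiv> b\<^sup>2 - 4 * c * \<kappa>"
  defines "S \<equiv> (b - sqrt D) / (2 * \<kappa>)"
  shows "0 < D" "0 \<le> S" "\<kappa> * S + \<beta> + \<kappa> * \<delta> < 1"
    "q + (K * \<beta> * S + 2 * \<beta> * \<delta> + \<kappa> * \<delta>\<^sup>2) / (1 - \<kappa> * S) = S"
proof -
  define t where "t = sqrt (K * \<beta>)"
  define d where "d = \<kappa> * \<delta>"
  define p where "p = \<kappa> * q"
  have t2: "t\<^sup>2 = K * \<beta>" "0 \<le> t" using nn K by (auto simp: t_def)
  have "t\<^sup>2 < 1" using K t2 by simp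
  then have t1: "t < 1" using t2(2) by (simp add: power2_less_1_iff)
  have "\<beta>\<^sup>2 \<le> K * \<beta>" using K nn unfolding power2_eq_square by (intro mult_right_mono)
  then have "\<beta>\<^sup>2 \<le> t\<^sup>2" unfolding t2 .
  then have bt: "\<beta> \<le> t" using t2(2) by (rule power2_le_imp_le)
  have d0: "0 \<le> d" "0 \<le> p" using nn by (simp_all add: d_def p_def)
  have dp: "2 * d + p < (1 - t)\<^sup>2"
    using small nn by (simp add: t_def d_def p_def field_simps)
  have b: "b = 1 - t\<^sup>2 + p" using t2 by (simp add: b_def p_def)
  have D: "D = (1 - t\<^sup>2 + p)\<^sup>2 - 4 * p - 8 * \<beta> * d - 4 * d\<^sup>2"
    unfolding D_def b c_def by (simp add: p_def d_def power2_eq_square algebra_simps)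
  define e where "e = (1 - t)\<^sup>2 - 2 * d - p"
  have e: "0 < e" using dp by (simp add: e_def)
  have p: "p = (1 - t)\<^sup>2 - 2 * d - e" by (simp add: e_def)
  have "D = 8 * d * (t - \<beta>) + e * (4 * (t + d) + e)"
    unfolding D p by (simp add: power2_eq_square algebra_simps)
  moreover have "0 < e * (4 * (t + d) + e)" using e t2(2) d0 by (intro mult_pos_pos) auto
  ultimately show D0: "0 < D" using d0 bt by (simp add: add_nonneg_pos)
  have c0: "0 \<le> c" using nn by (simp add: c_def)
  have "b \<ge> 0" using \<open>t\<^sup>2 < 1\<close> d0 b by simp
  moreover have "D \<le> b\<^sup>2" using c0 nn by (simp add: D_def)
  ultimately have "sqrt D \<le> b" by (simp add: real_le_lsqrt)
  then show S0: "0 \<le> S" using nn by (simp add: S_def)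
  have kS: "2 * (\<kappa> * S) = b - sqrt D" using nn by (simp add: S_def)
  have "0 < sqrt D" using D0 by simp
  moreover have "b + 2 * \<beta> + 2 * d \<le> 2"
  proof -
    have "b + 2 * \<beta> + 2 * d \<le> 1 - t\<^sup>2 + (1 - t)\<^sup>2 + 2 * t"
      using dp bt b by linarith
    also have "\<dots> = 2" by (simp add: power2_eq_square algebra_simps)
    finally show ?thesis .
  qed
  ultimately show *: "\<kappa> * S + \<beta> + \<kappa> * \<delta> < 1" using kS unfolding d_def[symmetric] by linarith
  then have kS1: "\<kappa> * S < 1" using nn d0 unfolding d_def by linarith
  have "(b - 2 * (\<kappa> * S))\<^sup>2 = b\<^sup>2 - 4 * c * \<kappa>"
    using kS D0 by (simp add: D_def)
  then have "\<kappa> * (\<kappa> * S\<^sup>2 - b * S + c) = 0"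
    by (simp add: power2_eq_square algebra_simps)
  then have "\<kappa> * S\<^sup>2 - b * S + c = 0" using nn by simp
  then have "(S - q) * (1 - \<kappa> * S) = K * \<beta> * S + 2 * \<beta> * \<delta> + \<kappa> * \<delta>\<^sup>2"
    by (simp add: b_def c_def power2_eq_square algebra_simps)
  then show "q + (K * \<beta> * S + 2 * \<beta> * \<delta> + \<kappa> * \<delta>\<^sup>2) / (1 - \<kappa> * S) = S"
    using kS1 by (simp add: field_simps)
qed

theorem theorem3p2:
  fixes m n :: nat
    and Q dQ A dA X_L :: "complex mat"
    and N :: "complex mat \<Rightarrow> real"
    and theta :: real
  defines "B \<equiv> hat m (inv_mat X_L) * A"
  defines "K \<equiv> min (theta * spec_norm B) (N B)"
  defines "kappa \<equiv> spec_norm (inv_mat X_L)"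
  defines "b \<equiv> 1 - K * spec_norm B + kappa * N dQ"
  defines "c \<equiv> N dQ + 2 * spec_norm B * N dA + kappa * (N dA)\<^sup>2"
  defines "D \<equiv> b\<^sup>2 - 4 * c * kappa"
  defines "S_err \<equiv> (b - sqrt D) / (2 * kappa)"
  assumes "0 < n" and "0 < m"
    and "pos_def n Q"
    and "A \<in> carrier_mat (m * n) n"
    and "dA \<in> carrier_mat (m * n) n"
    and "hermitian_mat n dQ"
    and "pos_def n (Q + dQ)"
    and "maximal_pd_solution m n A Q X_L"
    and "unitarily_invariant_norm N"
    and "is_theta N n m theta"
    and "K * spec_norm B < 1"
    and "2 * N dA + N dQ < (1 - sqrt (K * spec_norm B))\<^sup>2 / kappa"
  shows "D > 0 \<and>
    (\<exists>X_L'. maximal_pd_solution m n (A + dA) (Q + dQ) X_L' \<and> N (X_L' - X_L) \<le> S_err)"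
proof -
  have X: "pos_def n X_L" and sol: "hermitian_solution m n A Q X_L"
    using assms by (auto simp: maximal_pd_solution_def)
  note n = \<open>0 < n\<close> and A = \<open>A \<in> carrier_mat (m * n) n\<close> and dA = \<open>dA \<in> carrier_mat (m * n) n\<close>
    and N = \<open>unitarily_invariant_norm N\<close> and th = \<open>is_theta N n m theta\<close>
  have dQ: "dQ \<in> carrier_mat n n" and dQa: "mat_adjoint dQ = dQ"
    using \<open>hermitian_mat n dQ\<close> by (auto simp: hermitian_mat_def)
  note P = pos_def_inv_props[OF X X] and Xc = pos_def_carrier[OF X]
  have Q: "X_L + mat_adjoint A * hat m (inv_mat X_L) * A = Q"
    using sol hermitian_solution_pos_def_iff[OF X] by blast
  have kappa: "0 < kappa" unfolding kappa_def by (rule pos_def_inv_norm_pos[OF X n])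
  have theta: "1 \<le> theta" by (rule one_le_theta[OF N th n \<open>0 < m\<close>])
  have Bc: "B \<in> carrier_mat (m * n) n" unfolding B_def by (rule mult_carrier_mat[OF hat_carrier[OF P(1)] A])
  have BK: "spec_norm B \<le> K"
    using uinv_normD(5)[OF N Bc] mult_right_mono[OF theta, of "spec_norm B"] by (simp add: K_def)
  note bounds = root_bounds[OF spec_norm_nonneg uinv_normD(1)[OF N dA] uinv_normD(1)[OF N dQ] kappa BK
      \<open>K * spec_norm B < 1\<close> \<open>2 * N dA + N dQ < (1 - sqrt (K * spec_norm B))\<^sup>2 / kappa\<close>,
      folded b_def c_def, folded D_def, folded S_err_def]
  have kS: "kappa * S_err < 1"
    using bounds(3) kappa uinv_normD(1)[OF N dA] spec_norm_nonneg[of B] mult_nonneg_nonneg[of kappa "N dA"] by linarith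
  define At where "At = A + dA"
  have At: "At \<in> carrier_mat (m * n) n" using A dA by (simp add: At_def)
  \<comment> \<open>A bound of $\widehat{(X_L+E)^{-1}}\tilde A$ that is uniform in the ball; the square of it is the
    contraction constant.\<close>
  define rho where "rho = (spec_norm B + kappa * N dA) / (1 - kappa * S_err)"
  have rho: "0 \<le> rho" "rho < 1"
    using bounds(3) kS kappa uinv_normD(1)[OF N dA] by (auto simp: rho_def field_simps)
  define Phi where "Phi E = X_L + mat_adjoint A * hat m (inv_mat X_L) * A + dQ
      - mat_adjoint At * hat m (inv_mat (X_L + E)) * At - X_L" for E
  define C where "C = {E. hermitian_mat n E \<and> N E \<le> S_err}"
  have Cc: "E \<in> carrier_mat n n" if "E \<in> C" for E using that by (simp add: C_def hermitian_mat_def)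
  have Ck: "kappa * spec_norm E \<le> kappa * S_err" if "E \<in> C" for E
    using uinv_normD(5)[OF N Cc[OF that]] that kappa by (simp add: C_def)
  have CY: "pos_def n (X_L + E)" if "E \<in> C" for E
    by (rule pos_def_perturbation[OF X _ le_less_trans[OF Ck[OF that] kS] kappa])
      (use that in \<open>simp_all add: C_def kappa_def\<close>)
  have C_rho: "spec_norm (hat m (inv_mat (X_L + E)) * At) \<le> rho" if "E \<in> C" for E
  proof -
    have "spec_norm (hat m (inv_mat (X_L + E)) * At) \<le> (spec_norm B + kappa * spec_norm dA) / (1 - kappa * S_err)"
      using perturbed_coefficient_norm_le[OF X CY[OF that] Cc[OF that] A dA _ kS] Ck[OF that]
      by (simp add: At_def B_def kappa_def)
    also have "\<dots> \<le> rho"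
      unfolding rho_def using kS kappa uinv_normD(5)[OF N dA] by (intro divide_right_mono add_left_mono mult_left_mono) auto
    finally show ?thesis .
  qed
  have "\<exists>E \<in> C. Phi E = E"
  proof (rule matrix_contraction_fixpoint)
    show "C \<subseteq> carrier_mat n n" using Cc by blast
    show "E \<in> C" if "\<And>k. x k \<in> C" "E \<in> carrier_mat n n" "(\<lambda>k. spec_norm (x k - E)) \<longlonglongrightarrow> 0" for x E
      using norm_ball_closed[OF N _ that(2,3), where S = S_err] that(1) by (simp add: C_def)
    show "0 \<le> rho\<^sup>2" "rho\<^sup>2 < 1" using rho by (simp_all add: power2_less_1_iff)
    show "0\<^sub>m n n \<in> C"
      using uinv_normD(2)[OF N zero_carrier_mat, of n n] bounds(2) by (simp add: C_def hermitian_mat_def)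
    show "Phi E \<in> C" if E: "E \<in> C" for E
    proof -
      note R = pos_def_inv_props[OF CY[OF E] CY[OF E]] adjoint_inv_mat[OF CY[OF E]]
      have "N (Phi E) \<le> N dQ + (K * spec_norm B * S_err + 2 * spec_norm B * N dA + kappa * (N dA)\<^sup>2) / (1 - kappa * S_err)"
        unfolding Phi_def At_def K_def B_def kappa_def
        by (rule fixpoint_map_norm_le[OF N th X CY[OF E] Cc[OF E] A dA dQ])
          (use E kS theta in \<open>auto simp: C_def kappa_def\<close>)
      moreover have "mat_adjoint (mat_adjoint M * hat m H * M) = mat_adjoint M * hat m H * M"
        if "M \<in> carrier_mat (m * n) n" "H \<in> carrier_mat n n" "mat_adjoint H = H" for M H
        using that by (simp add: adjoint_mult mult_assoc_dim flip: hat_adjoint)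
      then have "mat_adjoint (Phi E) = Phi E"
        using Xc P(1) R(1,4) A At dQ dQa adjoint_inv_mat[OF X] pos_def_adjoint[OF X]
        by (simp add: Phi_def adjoint_add adjoint_minus)
      moreover have "Phi E \<in> carrier_mat n n" unfolding Phi_def by (rule minus_carrier_mat[OF Xc])
      ultimately show ?thesis using bounds(4) by (simp add: C_def hermitian_mat_def)
    qed
    show "spec_norm (Phi E - Phi F) \<le> rho\<^sup>2 * spec_norm (E - F)" if E: "E \<in> C" and F: "F \<in> C" for E F
    proof -
      note RE = pos_def_inv_props[OF CY[OF E] CY[OF E]] and RF = pos_def_inv_props[OF CY[OF F] CY[OF F]]
      define U where "U = hat m (inv_mat (X_L + E)) * At"
      define V where "V = hat m (inv_mat (X_L + F)) * At"
      have Vadj: "mat_adjoint V = mat_adjoint At * hat m (inv_mat (X_L + F))"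
        using At RF(1) by (simp add: V_def adjoint_mult adjoint_inv_mat[OF CY[OF F]] flip: hat_adjoint)
      have EF: "E - F \<in> carrier_mat n n" by (rule minus_carrier_mat[OF Cc[OF F]])
      have "X_L + E - (X_L + F) = E - F" using Xc Cc[OF E] Cc[OF F] by (intro eq_matI) auto
      then have diff: "inv_mat (X_L + F) - inv_mat (X_L + E) = inv_mat (X_L + F) * (E - F) * inv_mat (X_L + E)"
        using inv_mat_minus(1)[OF CY[OF F] CY[OF E]] by simp
      have "Phi E - Phi F = mat_adjoint At * hat m (inv_mat (X_L + F)) * At - mat_adjoint At * hat m (inv_mat (X_L + E)) * At"
        unfolding Phi_def by (rule eq_matI) (use Xc At A dQ in \<open>auto simp del: index_mult_mat(1)\<close>)
      also have "\<dots> = mat_adjoint At * hat m (inv_mat (X_L + F) - inv_mat (X_L + E)) * At"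
        using At RE(1) RF(1) Xc Cc[OF E] Cc[OF F] by (simp add: hat_minus mult_distrib_dim)
      also have "\<dots> = mat_adjoint V * (hat m (E - F) * U)"
        unfolding diff Vadj U_def using At RE(1) RF(1) Cc[OF E] Cc[OF F] by (simp add: hat_mult mult_assoc_dim)
      finally have "spec_norm (Phi E - Phi F) \<le> spec_norm (mat_adjoint V) * (spec_norm (hat m (E - F)) * spec_norm U)"
        using At RE(1) RF(1) Cc[OF E] Cc[OF F]
        by (auto simp: U_def V_def intro!: order_trans[OF spec_norm_mult mult_left_mono[OF spec_norm_mult]])
      also have "\<dots> \<le> rho * (spec_norm (E - F) * rho)"
        using order_trans[OF spec_norm_adjoint_le C_rho[OF F, folded V_def]] C_rho[OF E, folded U_def]
          spec_norm_hat_le[OF EF] rho by (intro mult_mono) auto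
      finally show ?thesis by (simp add: power2_eq_square algebra_simps)
    qed
  qed
  then obtain E where E: "E \<in> C" and fp: "Phi E = E" by blast
  note R = pos_def_inv_props[OF CY[OF E] CY[OF E]]
  let ?Y = "X_L + E"
  have "?Y + mat_adjoint At * hat m (inv_mat ?Y) * At = X_L + Phi E + mat_adjoint At * hat m (inv_mat ?Y) * At"
    by (simp only: fp)
  also have "\<dots> = Q + dQ"
    unfolding Q[symmetric] Phi_def
    by (rule eq_matI) (use Xc At A dQ R(1) in \<open>auto simp del: index_mult_mat(1)\<close>)
  finally have "hermitian_solution m n At (Q + dQ) ?Y"
    using hermitian_solution_pos_def_iff[OF CY[OF E]] by blast
  then have "maximal_pd_solution m n At (Q + dQ) ?Y"
    using maximal_if_spec_norm_less_1[OF CY[OF E] _ At] C_rho[OF E] rho(2) by simp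
  moreover have "?Y - X_L = E" using Xc Cc[OF E] by (intro eq_matI) auto
  ultimately show ?thesis using bounds(1) E by (auto simp: At_def C_def)
qed

end
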